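(* Let $D$ be a connected Eulerian digraph. Then the following are equivalent: (1) No two cycles of $D$ share an edge (i.e., $D$ is a bridgeless cactus digraph). (2) Every edge of $D$ is contained in exactly one cycle of $D$. (3) $\mathcal{B}(D)$ is a partition of $D$ into cycles. (4) $D$ has a unique partition into cycles. (5) $D\in\mathcal{S}$. (6) $|\mathcal{B}(D)| = |E(D)|-|V(D)|+1$. (7) For any $u\in V(D)$, $D$ has a unique spanning arborescence rooted at $u$. (8) $T(D)$ is a lattice (and in particular has a unique minimal element).
   Context: A digraph is a triple $D=(V(D),E(D),\psi)$ with $V(D),E(D)$ finite sets and $\psi:E(D)\to V(D)\times V(D)$ such that the two coordinates of $\psi(e)$ are distinct for every $e$ (no loops; parallel edges allowed). A walk is an alternating sequence $(v_0,e_1,v_1,\dots,e_d,v_d)$ with $\psi(e_i)=(v_{i-1},v_i)$; it is closed if $v_0=v_d$ and a trail if its edges are pairwise distinct. A circuit is an equivalence class of closed trails under cyclic rotation of the edge sequence; a cycle is a circuit with no repeated vertices (cycles have length $\ge 2$; length-2 cycles are digons). $\mathcal{B}(D)$ denotes the set of cycles of $D$, each also regarded as a subdigraph. An Eulerian circuit is a circuit traversing every edge of $D$; $D$ is Eulerian if it has an Eulerian circuit. A partition of $D$ into cycles is a set $\mathcal{A}\subseteq\mathcal{B}(D)$ such that $E(D)$ is the disjoint union of the edge sets of the members of $\mathcal{A}$. For digraphs $D_1,D_2$ with $|V(D_1)\cap V(D_2)|=1$, $D_1\ast D_2$ denotes their union (undefined otherwise). $\mathcal{S}$ is the closure of the collection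 of all finite directed cycles under the operation $\ast$. An arborescence rooted at $u$ is a spanning subdigraph which is a rooted tree with all edges directed away from $u$. $T(D)$ is the subposet of the partition lattice of $E(D)$ (ordered by refinement) induced by the partitions of $E(D)$ into parts each of which spans a connected Eulerian subdigraph. *)

theory Defs
  imports "Graph_Theory.Graph_Theory" "HOL-Algebra.Lattice"
begin

section \<open>Circuits and cycles\<close>

text \<open>
  A closed trail with at least one arc is determined by its arc list. The trivial walk is not
  taken as a circuit: it has no repeated vertices and would otherwise be a cycle of length 0.
\<close>

definition closed_trail :: "('a,'b) pre_digraph \<Rightarrow> 'b list \<Rightarrow> bool" where
  "closed_trail G p \<longleftrightarrow> p \<noteq> [] \<and> (\<exists>u. pre_digraph.trail G u p u)"

definition rotation :: "('a,'b) pre_digraph \<Rightarrow> ('b list \<times> 'b list) set" where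
  "rotation G = {(p, q). closed_trail G p \<and> (\<exists>n. q = rotate n p)}"

definition circuits :: "('a,'b) pre_digraph \<Rightarrow> 'b list set set" where
  "circuits G = {p. closed_trail G p} // rotation G"

definition circuit_arcs :: "'b list set \<Rightarrow> 'b set" where
  "circuit_arcs c = (\<Union>p\<in>c. set p)"

definition cycles :: "('a,'b) pre_digraph \<Rightarrow> 'b list set set" where
  "cycles G = {c \<in> circuits G. \<forall>p\<in>c. pre_digraph.cycle G p}"

definition eulerian :: "('a,'b) pre_digraph \<Rightarrow> bool" where
  "eulerian G \<longleftrightarrow> (\<exists>c\<in>circuits G. circuit_arcs c = arcs G)"

definition cycle_partition :: "('a,'b) pre_digraph \<Rightarrow> 'b list set set \<Rightarrow> bool" where
  "cycle_partition G A \<longleftrightarrow> A \<subseteq> cycles G \<and>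
     disjoint_family_on circuit_arcs A \<and> (\<Union>c\<in>A. circuit_arcs c) = arcs G"

definition arc_subgraph :: "('a,'b) pre_digraph \<Rightarrow> 'b set \<Rightarrow> ('a,'b) pre_digraph" where
  "arc_subgraph G F = \<lparr>verts = tail G ` F \<union> head G ` F, arcs = F, tail = tail G, head = head G\<rparr>"


section \<open>The closure of the directed cycles under one-vertex amalgamation\<close>

definition cycle_digraph :: "('a,'b) pre_digraph \<Rightarrow> bool" where
  "cycle_digraph C \<longleftrightarrow> fin_digraph C \<and> loopfree_digraph C \<and>
     (\<exists>c\<in>cycles C. C = arc_subgraph C (circuit_arcs c))"

text \<open>
  Since \<^const>\<open>tail\<close> and \<^const>\<open>head\<close> are total functions, \<^const>\<open>compatible\<close> says that the
  incidence maps of the two digraphs agree, so that their union makes sense.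
\<close>

inductive_set cycle_closure :: "('a,'b) pre_digraph set" where
  cycle: "cycle_digraph C \<Longrightarrow> C \<in> cycle_closure"
| amalgam: "D1 \<in> cycle_closure \<Longrightarrow> D2 \<in> cycle_closure \<Longrightarrow> compatible D1 D2 \<Longrightarrow>
    card (verts D1 \<inter> verts D2) = 1 \<Longrightarrow> Digraph_Component.union D1 D2 \<in> cycle_closure"


section \<open>Arborescences\<close>

text \<open>
  Each arc \<open>e\<close> is doubled to \<open>(e, True)\<close>, traversed forwards, and \<open>(e, False)\<close>, traversed
  backwards. Directed paths of the result are exactly the paths of the underlying undirected
  multigraph. The library's \<^const>\<open>tree\<close> is not usable here, as it only excludes
  directed cycles.
\<close>

definition underlying :: "('a,'b) pre_digraph \<Rightarrow> ('a, 'b \<times> bool) pre_digraph" where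
  "underlying G = \<lparr>verts = verts G, arcs = arcs G \<times> UNIV,
     tail = (\<lambda>(e, b). if b then tail G e else head G e),
     head = (\<lambda>(e, b). if b then head G e else tail G e)\<rparr>"

definition undirected_tree :: "('a,'b) pre_digraph \<Rightarrow> bool" where
  "undirected_tree G \<longleftrightarrow> verts G \<noteq> {} \<and>
     (\<forall>x\<in>verts G. \<forall>y\<in>verts G. \<exists>!p. pre_digraph.apath (underlying G) x p y)"

text \<open>An arc points away from \<open>u\<close> if it is the last step, taken forwards, of a path from \<open>u\<close>.\<close>

definition directed_away :: "('a,'b) pre_digraph \<Rightarrow> 'a \<Rightarrow> bool" where
  "directed_away G u \<longleftrightarrow>
     (\<forall>e\<in>arcs G. \<exists>p. pre_digraph.apath (underlying G) u (p @ [(e, True)]) (head G e))"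

definition arborescence :: "('a,'b) pre_digraph \<Rightarrow> 'a \<Rightarrow> ('a,'b) pre_digraph \<Rightarrow> bool" where
  "arborescence G u T \<longleftrightarrow> spanning T G \<and> u \<in> verts T \<and> undirected_tree T \<and> directed_away T u"


section \<open>The poset of partitions into connected Eulerian parts\<close>

definition eulerian_partitions :: "('a,'b) pre_digraph \<Rightarrow> 'b set set gorder" where
  "eulerian_partitions G =
     \<lparr>carrier = {P. partition_on (arcs G) P \<and>
        (\<forall>F\<in>P. connected (arc_subgraph G F) \<and> eulerian (arc_subgraph G F))},
      eq = (=), le = refines (arcs G)\<rparr>"

definition minimal :: "('c, 'm) gorder_scheme \<Rightarrow> 'c \<Rightarrow> bool" where
  "minimal L x \<longleftrightarrow> x \<in> carrier L \<and> (\<forall>y\<in>carrier L. le L y x \<longrightarrow> y = x)"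

end

theory Submission
  imports Defs
begin

text \<open>
  The arc sets of the cycles are exactly the minimal nonempty balanced arc sets, where balanced
  means that every vertex has equal in- and outdegree. Hence every balanced set is a disjoint union
  of cycles, every one of its arcs lies on a cycle, and its components are strongly connected.

  If two cycles share an arc, each of them extends to a partition into cycles, and deleting the
  shared arc from both leaves two paths with the same ends, which extend to two arborescences.
  Conversely, in a cactus a component left after deleting a cycle \<open>X\<close> meets \<open>X\<close> in one
  vertex. Splitting it off gives the decomposition under one-vertex amalgamation; moreover, the flow
  across this component shows that every circulation is constant on \<open>X\<close>, so that paths, and
  hence arborescences, are unique.

  In general a component that meets \<open>X\<close> in \<open>s\<close> vertices is split off, and if
  \<open>s \<ge> 2\<close>, then at least \<open>s\<close> cycles cross between the two pieces, one more than
  what the bound \<open>|B(D)| \<ge> |E| - |V| + 1\<close> needs.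

  Joins of partitions into connected Eulerian parts always exist, so they form a lattice as soon as
  there is a least partition, and the partitions into cycles are minimal.
\<close>

section \<open>Balanced arc sets\<close>

text \<open>Each of the eight conditions is shown equivalent to the single predicate
  \<open>cactus\<close> on the arc set. Cycles enter as arc sets rather than as lists or rotation
  classes because balance is a linear condition: it survives differences and disjoint unions, so a
  cycle is found by minimality and not by following a walk until it closes. Balance also yields
  strong connectivity: no net flow crosses a vertex set, so a set that no arc leaves is one that no
  arc enters. All this depends on the incidence maps only, hence a locale over \<open>t\<close> and
  \<open>h\<close> alone: the same facts serve all arc subsets of a digraph at once and, with the
  maps \<open>ut\<close> and \<open>uh\<close>, the paths of the underlying undirected graph.
  Equality in the cycle count must single out the cacti, so that induction carries the bound and its
  equality case together.\<close>

locale incidence =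
  fixes t h :: "'b \<Rightarrow> 'a"
begin

text \<open>The net outflow at \<open>v\<close> under the weights \<open>f\<close>. Weights are
  signed so that the difference of two paths can be treated as a flow; a loop contributes 0.\<close>

definition flow :: "('b \<Rightarrow> int) \<Rightarrow> 'b set \<Rightarrow> 'a \<Rightarrow> int" where
  "flow f X v = (\<Sum>e\<in>X. f e * (of_bool (t e = v) - of_bool (h e = v)))"

definition balanced :: "'b set \<Rightarrow> bool" where
  "balanced X \<longleftrightarrow> finite X \<and> (\<forall>v. flow (\<lambda>_. 1) X v = 0)"

definition adj :: "'b set \<Rightarrow> ('a \<times> 'a) set" where
  "adj X = (\<lambda>e. (t e, h e)) ` X"

definition ends :: "'b set \<Rightarrow> 'a set" where
  "ends X = t ` X \<union> h ` X"

text \<open>Directed reachability is asked for in both directions; for balanced sets reachability is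
  symmetric (\<open>balanced_reach_sym\<close>), so this amounts to connectedness of the underlying
  graph.\<close>

definition conn :: "'b set \<Rightarrow> bool" where
  "conn X \<longleftrightarrow> (\<forall>u\<in>ends X. \<forall>v\<in>ends X. (u, v) \<in> (adj X)\<^sup>*)"

definition ecycle :: "'b set \<Rightarrow> bool" where
  "ecycle X \<longleftrightarrow> balanced X \<and> X \<noteq> {} \<and> (\<forall>Y\<subseteq>X. balanced Y \<longrightarrow> Y = {} \<or> Y = X)"

lemma ends_mono: "X \<subseteq> Y \<Longrightarrow> ends X \<subseteq> ends Y"
  by (auto simp: ends_def)

lemma ends_Un: "ends (X \<union> Y) = ends X \<union> ends Y"
  by (auto simp: ends_def)

lemma finite_ends: "finite X \<Longrightarrow> finite (ends X)"
  by (auto simp: ends_def)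

lemma adj_mono: "X \<subseteq> Y \<Longrightarrow> adj X \<subseteq> adj Y"
  by (auto simp: adj_def)

lemma reach_mono: "(u, v) \<in> (adj X)\<^sup>* \<Longrightarrow> X \<subseteq> Y \<Longrightarrow> (u, v) \<in> (adj Y)\<^sup>*"
  using rtrancl_mono[OF adj_mono] by blast

lemma arc_reach: "e \<in> X \<Longrightarrow> (t e, h e) \<in> (adj X)\<^sup>*"
  by (auto simp: adj_def)

lemma flow_Un_disjoint:
  "finite X \<Longrightarrow> finite Y \<Longrightarrow> X \<inter> Y = {} \<Longrightarrow> flow f (X \<union> Y) v = flow f X v + flow f Y v"
  by (simp add: flow_def sum.union_disjoint)

lemma flow_Diff:
  "finite X \<Longrightarrow> Y \<subseteq> X \<Longrightarrow> flow f (X - Y) v = flow f X v - flow f Y v"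
  by (simp add: flow_def sum_diff)

lemma flow_notin: "v \<notin> ends X \<Longrightarrow> flow f X v = 0"
  by (auto simp: flow_def ends_def intro!: sum.neutral)

lemma balanced_empty: "balanced {}"
  by (simp add: balanced_def flow_def)

lemma balanced_finite: "balanced X \<Longrightarrow> finite X"
  by (simp add: balanced_def)

lemma balanced_Un: "balanced X \<Longrightarrow> balanced Y \<Longrightarrow> X \<inter> Y = {} \<Longrightarrow> balanced (X \<union> Y)"
  by (simp add: balanced_def flow_Un_disjoint)

lemma balanced_Diff: "balanced X \<Longrightarrow> balanced Y \<Longrightarrow> Y \<subseteq> X \<Longrightarrow> balanced (X - Y)"
  by (simp add: balanced_def flow_Diff)

lemma balanced_Union:
  assumes "finite P" "disjoint P" "\<And>X. X \<in> P \<Longrightarrow> balanced X"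
  shows "balanced (\<Union>P)"
  using assms
proof (induction P rule: finite_induct)
  case (insert X P)
  have "X \<inter> \<Union>P = {}"
    using insert.prems(1) insert.hyps(2) by (force simp: pairwise_insert disjnt_def)
  moreover have "balanced (\<Union>P)"
    using insert.IH insert.prems by (simp add: pairwise_insert)
  ultimately show ?case
    using balanced_Un[of X "\<Union>P"] insert.prems(2)[of X] by simp
qed (simp add: balanced_empty)

text \<open>Summing conservation over \<open>S\<close> and swapping the sums cancels every arc
  inside \<open>S\<close>; what remains is the net flow leaving \<open>S\<close>. Only the ends of
  \<open>X\<close> matter, which keeps the sum finite.\<close>

lemma cut_flow:
  assumes "finite X" "\<And>v. flow f X v = 0"
  shows "(\<Sum>e\<in>X. f e * (of_bool (t e \<in> S) - of_bool (h e \<in> S))) = 0"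
proof -
  let ?S = "S \<inter> ends X"
  have fin: "finite ?S"
    using assms(1) finite_ends by blast
  have "0 = (\<Sum>v\<in>?S. flow f X v)"
    by (simp add: assms(2))
  also have "\<dots> = (\<Sum>e\<in>X. \<Sum>v\<in>?S. f e * (of_bool (t e = v) - of_bool (h e = v)))"
    unfolding flow_def by (rule sum.swap)
  also have "\<dots> = (\<Sum>e\<in>X. f e * (of_bool (t e \<in> S) - of_bool (h e \<in> S)))"
  proof (rule sum.cong[OF refl])
    fix e assume e: "e \<in> X"
    have one: "(\<Sum>v\<in>?S. of_bool (w = v)) = (of_bool (w \<in> S) :: int)" if "w \<in> ends X" for w
    proof -
      have "(\<Sum>v\<in>?S. of_bool (w = v)) = (\<Sum>v\<in>?S. if w = v then 1 else 0 :: int)"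
        by (rule sum.cong) auto
      then show ?thesis using fin that by simp
    qed
    have "t e \<in> ends X" "h e \<in> ends X"
      using e by (auto simp: ends_def)
    then show "(\<Sum>v\<in>?S. f e * (of_bool (t e = v) - of_bool (h e = v)))
        = f e * (of_bool (t e \<in> S) - of_bool (h e \<in> S))"
      by (simp add: sum_distrib_left[symmetric] sum_subtractf one)
  qed
  finally show ?thesis by simp
qed

text \<open>The net flow out of \<open>S\<close> is zero, so if nothing leaves \<open>S\<close>,
  nothing can enter it.\<close>

lemma balanced_closed_backwards:
  assumes X: "balanced X" and cl: "\<And>e. e \<in> X \<Longrightarrow> t e \<in> S \<Longrightarrow> h e \<in> S"
    and e: "e \<in> X" "h e \<in> S"
  shows "t e \<in> S"
proof -
  let ?g = "\<lambda>e. of_bool (h e \<in> S) - of_bool (t e \<in> S) :: int"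
  have "(\<Sum>e\<in>X. ?g e) = 0"
    using cut_flow[of X "\<lambda>_. 1" S] X by (simp add: balanced_def sum_subtractf)
  moreover have "\<forall>e\<in>X. 0 \<le> ?g e" using cl by auto
  ultimately have "?g e = 0"
    using X e(1) sum_nonneg_eq_0_iff[of X ?g] by (auto simp: balanced_def)
  then show ?thesis using e(2) by (auto split: if_splits)
qed

text \<open>No arc of \<open>X\<close> crosses the border of \<open>S\<close> in either direction:
  vertices in \<open>S\<close> keep all their arcs, the others lose all of theirs.\<close>

lemma balanced_closed_part:
  assumes X: "balanced X" and cl: "\<And>e. e \<in> X \<Longrightarrow> t e \<in> S \<Longrightarrow> h e \<in> S"
  shows "balanced {e \<in> X. t e \<in> S}"
proof -
  let ?Y = "{e \<in> X. t e \<in> S}"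
  have iff: "t e \<in> S \<longleftrightarrow> h e \<in> S" if "e \<in> X" for e
    using that cl balanced_closed_backwards[OF X cl] by blast
  have "flow (\<lambda>_. 1) ?Y v = 0" for v
  proof (cases "v \<in> S")
    case True
    have "flow (\<lambda>_. 1) ?Y v = flow (\<lambda>_. 1) X v"
      unfolding flow_def using X iff True
      by (intro sum.mono_neutral_left) (auto simp: balanced_def)
    then show ?thesis using X by (simp add: balanced_def)
  next
    case False
    then have "v \<notin> ends ?Y" using iff by (auto simp: ends_def)
    then show ?thesis by (rule flow_notin)
  qed
  then show ?thesis using X by (simp add: balanced_def)
qed

section \<open>Reachability and components of balanced sets\<close>

lemma reach_closed: "e \<in> X \<Longrightarrow> (u, t e) \<in> (adj X)\<^sup>* \<Longrightarrow> (u, h e) \<in> (adj X)\<^sup>*"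
  by (meson arc_reach rtrancl_trans)

text \<open>The vertices reachable from \<open>h e\<close> form a set that no arc leaves. As no arc
  enters it either, \<open>e\<close> must start in it.\<close>

lemma balanced_reach_arc:
  assumes "balanced X" "e \<in> X"
  shows "(h e, t e) \<in> (adj X)\<^sup>*"
  using balanced_closed_backwards[OF assms(1), where S = "(adj X)\<^sup>* `` {h e}" and e = e]
    reach_closed assms(2) by auto

lemma balanced_reach_sym:
  assumes "balanced X" "(u, v) \<in> (adj X)\<^sup>*"
  shows "(v, u) \<in> (adj X)\<^sup>*"
  using assms(2)
proof (induction rule: rtrancl_induct)
  case (step y z)
  then obtain e where "e \<in> X" "y = t e" "z = h e" by (auto simp: adj_def)
  then show ?case using balanced_reach_arc[OF assms(1)] step.IH by (meson rtrancl_trans)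
qed simp

lemma balanced_connI:
  assumes X: "balanced X" and u: "\<And>e. e \<in> X \<Longrightarrow> (u, t e) \<in> (adj X)\<^sup>*"
  shows "conn X"
proof -
  have *: "(u, v) \<in> (adj X)\<^sup>*" if "v \<in> ends X" for v
    using that u reach_closed by (auto simp: ends_def)
  then show ?thesis
    unfolding conn_def using balanced_reach_sym[OF X] by (meson rtrancl_trans)
qed

text \<open>Forward reachability from \<open>u\<close> describes an undirected component, because
  reachability is symmetric in a balanced \<open>X\<close>. If \<open>u\<close> is not an end of
  \<open>X\<close>, the result is empty.\<close>

definition component :: "'b set \<Rightarrow> 'a \<Rightarrow> 'b set" where
  "component X u = {e \<in> X. (u, t e) \<in> (adj X)\<^sup>*}"

lemma component_subset: "component X u \<subseteq> X"
  by (auto simp: component_def)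

lemma balanced_component:
  assumes "balanced X" shows "balanced (component X u)"
  using balanced_closed_part[OF assms, of "(adj X)\<^sup>* `` {u}"] reach_closed[of _ X u]
  by (simp add: component_def)

lemma reach_component:
  "(u, v) \<in> (adj X)\<^sup>* \<longleftrightarrow> (u, v) \<in> (adj (component X u))\<^sup>*"
proof
  assume "(u, v) \<in> (adj X)\<^sup>*"
  then show "(u, v) \<in> (adj (component X u))\<^sup>*"
  proof (induction rule: rtrancl_induct)
    case (step y z)
    then have "(y, z) \<in> adj (component X u)"
      by (auto simp: adj_def component_def)
    then show ?case using step.IH by simp
  qed simp
qed (use reach_mono component_subset in blast)

lemma conn_component:
  assumes "balanced X" shows "conn (component X u)"
proof (rule balanced_connI[OF balanced_component[OF assms]])
  fix e assume "e \<in> component X u"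
  then show "(u, t e) \<in> (adj (component X u))\<^sup>*"
    using reach_component[of u "t e" X] by (simp add: component_def)
qed

lemma component_arc: "e \<in> X \<Longrightarrow> e \<in> component X (t e)"
  by (simp add: component_def)

lemma ends_component:
  assumes "balanced X" "u \<in> ends X"
  shows "ends (component X u) = {v. (u, v) \<in> (adj X)\<^sup>*}"
proof
  show "ends (component X u) \<subseteq> {v. (u, v) \<in> (adj X)\<^sup>*}"
    using reach_closed by (auto simp: ends_def component_def)
  have u: "u \<in> ends (component X u)"
  proof -
    obtain e where e: "e \<in> X" "u = t e \<or> u = h e"
      using assms(2) by (auto simp: ends_def)
    then have "e \<in> component X u"
      using balanced_reach_arc[OF assms(1)] by (auto simp: component_def)
    then show ?thesis using e(2) by (auto simp: ends_def)
  qed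
  show "{v. (u, v) \<in> (adj X)\<^sup>*} \<subseteq> ends (component X u)"
  proof safe
    fix v assume "(u, v) \<in> (adj X)\<^sup>*"
    then show "v \<in> ends (component X u)"
    proof (induction rule: rtrancl_induct)
      case base show ?case by (rule u)
    next
      case (step y z)
      then obtain e where "e \<in> X" "y = t e" "z = h e" by (auto simp: adj_def)
      then show ?case using step.hyps by (auto simp: ends_def component_def)
    qed
  qed
qed

section \<open>Minimal balanced sets\<close>

lemma ecycle_balanced: "ecycle C \<Longrightarrow> balanced C"
  and ecycle_nonempty: "ecycle C \<Longrightarrow> C \<noteq> {}"
  by (auto simp: ecycle_def)

lemma ecycle_finite: "ecycle C \<Longrightarrow> finite C"
  by (simp add: ecycle_balanced balanced_finite)

lemma ecycle_minimal: "ecycle C \<Longrightarrow> balanced Y \<Longrightarrow> Y \<noteq> {} \<Longrightarrow> Y \<subseteq> C \<Longrightarrow> Y = C"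
  by (auto simp: ecycle_def)

text \<open>A component of \<open>C\<close> is a nonempty balanced subset, hence all of
  \<open>C\<close> by minimality.\<close>

lemma ecycle_conn:
  assumes "ecycle C" shows "conn C"
proof -
  obtain e where e: "e \<in> C" using ecycle_nonempty[OF assms] by blast
  have "component C (t e) = C"
    using ecycle_minimal[OF assms balanced_component[OF ecycle_balanced[OF assms]]]
      component_arc[OF e] component_subset by blast
  then show ?thesis using conn_component[OF ecycle_balanced[OF assms], of "t e"] by simp
qed

lemma ex_ecycle:
  assumes "balanced X" "X \<noteq> {}" shows "\<exists>C\<subseteq>X. ecycle C"
  using balanced_finite[OF assms(1)] assms
proof (induction X rule: finite_psubset_induct)
  case (psubset X)
  show ?case
  proof (cases "ecycle X")
    case False
    then obtain Y where "Y \<subset> X" "balanced Y" "Y \<noteq> {}"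
      using psubset.prems unfolding ecycle_def by blast
    then obtain C where "C \<subseteq> Y" "ecycle C" using psubset.IH by meson
    then show ?thesis using \<open>Y \<subset> X\<close> by blast
  qed blast
qed

text \<open>The directed form of Veblen's theorem: what remains after removing a minimal balanced
  subset is balanced again.\<close>

lemma partition_into_ecycles:
  assumes "balanced X" shows "\<exists>P. partition_on X P \<and> (\<forall>C\<in>P. ecycle C)"
  using balanced_finite[OF assms] assms
proof (induction X rule: finite_psubset_induct)
  case (psubset X)
  show ?case
  proof (cases "X = {}")
    case True
    then show ?thesis by (auto simp: partition_on_def)
  next
    case False
    then obtain C where C: "C \<subseteq> X" "ecycle C" using ex_ecycle psubset.prems by blast
    then obtain P where P: "partition_on (X - C) P" "\<forall>C\<in>P. ecycle C"
      using psubset.IH[of "X - C"] balanced_Diff[OF psubset.prems] ecycle_balanced ecycle_nonempty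
      by blast
    have "disjnt C (\<Union>P)" using P(1) by (auto simp: partition_on_def disjnt_def)
    then have "partition_on X (insert C P)"
      using P(1) C ecycle_nonempty by (simp add: partition_on_insert)
    then show ?thesis using P(2) C(2) by blast
  qed
qed

lemma arc_in_ecycle:
  assumes "balanced X" "e \<in> X" shows "\<exists>C. ecycle C \<and> e \<in> C \<and> C \<subseteq> X"
  using partition_into_ecycles[OF assms(1)] assms(2) by (auto simp: partition_on_def)


section \<open>Paths\<close>

fun walk :: "'a \<Rightarrow> 'b list \<Rightarrow> 'a \<Rightarrow> bool" where
  "walk u [] v \<longleftrightarrow> u = v"
| "walk u (e # p) v \<longleftrightarrow> t e = u \<and> walk (h e) p v"

text \<open>A simple path: start and heads are all distinct, so a path from \<open>u\<close> to
  \<open>u\<close> is empty. Cycles are therefore handled as an arc \<open>e\<close> together with a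
  path from \<open>h e\<close> to \<open>t e\<close>.\<close>

definition spath :: "'a \<Rightarrow> 'b list \<Rightarrow> 'a \<Rightarrow> bool" where
  "spath u p v \<longleftrightarrow> walk u p v \<and> distinct (u # map h p)"

lemma spath_Nil: "spath u [] v \<longleftrightarrow> u = v"
  by (simp add: spath_def)

lemma spath_Cons:
  "spath u (e # p) v \<longleftrightarrow> t e = u \<and> spath (h e) p v \<and> u \<noteq> h e \<and> u \<notin> h ` set p"
  by (auto simp: spath_def)

lemma spath_distinct: "spath u p v \<Longrightarrow> distinct p"
  by (simp add: spath_def distinct_map)

lemma spath_suffix:
  "spath u p v \<Longrightarrow> w \<in> insert u (h ` set p) \<Longrightarrow> \<exists>q. spath w q v \<and> set q \<subseteq> set p"
proof (induction p arbitrary: u)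
  case (Cons e p)
  show ?case
  proof (cases "w = u")
    case False
    then have "w \<in> insert (h e) (h ` set p)" using Cons.prems(2) by auto
    then obtain q where "spath w q v" "set q \<subseteq> set p"
      using Cons.IH[of "h e"] Cons.prems(1) by (auto simp: spath_Cons)
    then show ?thesis by auto
  qed (use Cons.prems in blast)
qed (auto simp: spath_Nil)

text \<open>Built from the front: when the new start vertex already lies on the path, the path is
  cut down to its suffix from there.\<close>

lemma ex_spath:
  assumes "(u, v) \<in> (adj X)\<^sup>*"
  shows "\<exists>p. spath u p v \<and> set p \<subseteq> X"
  using assms
proof (induction rule: converse_rtrancl_induct)
  case base
  show ?case by (rule exI[of _ "[]"]) (simp add: spath_Nil)
next
  case (step y z)
  then obtain p where p: "spath z p v" "set p \<subseteq> X" by blast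
  obtain e where e: "e \<in> X" "t e = y" "h e = z" using step.hyps(1) unfolding adj_def by blast
  show ?case
  proof (cases "y \<in> insert z (h ` set p)")
    case True
    then obtain q where "spath y q v" "set q \<subseteq> set p" using spath_suffix[OF p(1)] by blast
    then show ?thesis using p(2) by (intro exI[of _ q]) simp
  next
    case False
    then have "spath y (e # p) v" using p e by (auto simp: spath_Cons)
    moreover have "set (e # p) \<subseteq> X" using p e by simp
    ultimately show ?thesis by (intro exI[of _ "e # p"] conjI)
  qed
qed

text \<open>The contributions telescope. Distinctness matters because \<open>set p\<close> forgets
  how often an arc is used.\<close>

lemma walk_flow:
  "walk u p v \<Longrightarrow> distinct p \<Longrightarrow> flow (\<lambda>_. 1) (set p) x = of_bool (u = x) - of_bool (v = x)"
proof (induction p arbitrary: u)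
  case (Cons e p)
  then have "flow (\<lambda>_. 1) (set p) x = of_bool (h e = x) - of_bool (v = x)" by simp
  then show ?case using Cons.prems by (simp add: flow_def)
qed (simp add: flow_def)

lemma spath_flow: "spath u p v \<Longrightarrow> flow (\<lambda>_. 1) (set p) x = of_bool (u = x) - of_bool (v = x)"
  using walk_flow[of u p v x] spath_distinct[of u p v] by (simp add: spath_def)

lemma walk_balanced: "walk u p u \<Longrightarrow> distinct p \<Longrightarrow> balanced (set p)"
  by (simp add: balanced_def walk_flow)

lemma spath_last: "spath u p v \<Longrightarrow> v \<in> insert u (h ` set p)"
  by (induction p arbitrary: u) (auto simp: spath_Nil spath_Cons)

text \<open>A simple path leaves each vertex at most once and never its last one. The claims go
  together: the third is what lets the induction exclude the first vertex from the later
  tails.\<close>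

lemma spath_tails:
  "spath u p v \<Longrightarrow> v \<notin> t ` set p \<and> inj_on t (set p) \<and> t ` set p \<subseteq> insert u (h ` set p)"
proof (induction p arbitrary: u)
  case (Cons e p)
  then have IH: "v \<notin> t ` set p" "inj_on t (set p)" "t ` set p \<subseteq> insert (h e) (h ` set p)"
    and e: "t e = u" "u \<notin> insert (h e) (h ` set p)" and p: "spath (h e) p v"
    by (auto simp: spath_Cons)
  have "v \<noteq> u" using spath_last[OF p] e(2) by blast
  moreover have "t e \<notin> t ` set p" using IH(3) e by blast
  ultimately show ?case using IH e by auto
qed (auto simp: spath_Nil)

lemma spath_append_arc:
  "spath u (p @ [e]) v \<longleftrightarrow> spath u p (t e) \<and> h e = v \<and> v \<notin> insert u (h ` set p)"
  by (induction p arbitrary: u) (auto simp: spath_Nil spath_Cons)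

text \<open>Without an arc into \<open>t e\<close>, the net outflow there would count the arcs
  leaving it, of which \<open>e\<close> is one.\<close>

lemma balanced_preceding_arc:
  assumes "balanced X" "e \<in> X" shows "\<exists>a\<in>X. h a = t e"
proof (rule ccontr)
  assume no: "\<not> ?thesis"
  have "(\<Sum>a\<in>X. of_bool (t a = t e)) = flow (\<lambda>_. 1) X (t e)"
    unfolding flow_def using no by (intro sum.cong) auto
  then have "(\<Sum>a\<in>X. of_bool (t a = t e)) = (0 :: int)"
    using assms(1) by (simp add: balanced_def)
  then show False
    using assms balanced_finite by (subst (asm) sum_nonneg_eq_0_iff) auto
qed

lemma balanced_following_arc:
  assumes "balanced X" "e \<in> X" shows "\<exists>a\<in>X. t a = h e"
proof (rule ccontr)
  assume no: "\<not> ?thesis"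
  have "flow (\<lambda>_. 1) X (h e) = (\<Sum>a\<in>X. - of_bool (h a = h e))"
    unfolding flow_def using no by (intro sum.cong) auto
  then have "(\<Sum>a\<in>X. of_bool (h a = h e)) = (0 :: int)"
    using assms(1) by (simp add: balanced_def sum_negf)
  then show False
    using assms balanced_finite by (subst (asm) sum_nonneg_eq_0_iff) auto
qed

lemma balanced_ends: "balanced X \<Longrightarrow> ends X = t ` X" "balanced X \<Longrightarrow> ends X = h ` X"
  by (auto simp: ends_def image_iff dest: balanced_preceding_arc balanced_following_arc)
    (metis balanced_preceding_arc balanced_following_arc)+

text \<open>No arc of the path enters its first vertex, whereas a balanced set containing the first
  arc would have to enter it; so the arcs drop out of \<open>Y\<close> one after another.\<close>

lemma spath_acyclic: "spath u p v \<Longrightarrow> balanced Y \<Longrightarrow> Y \<subseteq> set p \<Longrightarrow> Y = {}"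
proof (induction p arbitrary: u)
  case (Cons e p)
  have "e \<notin> Y"
  proof
    assume "e \<in> Y"
    then obtain a where "a \<in> Y" "h a = t e"
      using balanced_preceding_arc Cons.prems(2) by blast
    then show False using Cons.prems(1,3) by (auto simp: spath_Cons)
  qed
  then have "Y \<subseteq> set p" using Cons.prems(3) by auto
  then show ?case using Cons.IH[of "h e"] Cons.prems(1,2) by (simp add: spath_Cons)
qed simp

text \<open>Cutting the path at its first vertex in \<open>J\<close> makes it avoid \<open>J\<close>
  before its end; this later keeps the crossing cycles of different vertices apart.\<close>

lemma spath_first_hit:
  "spath u p v \<Longrightarrow> v \<in> J \<Longrightarrow>
    \<exists>q w. spath u q w \<and> set q \<subseteq> set p \<and> w \<in> J \<and> t ` set q \<inter> J = {}"
proof (induction p arbitrary: u)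
  case Nil
  then have "spath u [] u \<and> u \<in> J" by (simp add: spath_Nil)
  then show ?case by fastforce
next
  case (Cons e p)
  show ?case
  proof (cases "u \<in> J")
    case True
    then have "spath u [] u \<and> u \<in> J" by (simp add: spath_Nil)
    then show ?thesis by fastforce
  next
    case False
    obtain q w where q: "spath (h e) q w" "set q \<subseteq> set p" "w \<in> J" "t ` set q \<inter> J = {}"
      using Cons.IH[of "h e"] Cons.prems by (auto simp: spath_Cons)
    then have "spath u (e # q) w" using Cons.prems(1) by (auto simp: spath_Cons)
    moreover have "t ` set (e # q) \<inter> J = {}"
      using q(4) False Cons.prems(1) by (auto simp: spath_Cons)
    moreover have "set (e # q) \<subseteq> set (e # p)" using q(2) by auto
    ultimately show ?thesis using q(3) by blast
  qed
qed

text \<open>A simple path in \<open>C\<close> from \<open>h e\<close> back to \<open>t e\<close>,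
  closed up by \<open>e\<close>, is balanced, so minimality leaves no further arc in
  \<open>C\<close>.\<close>

lemma ecycle_spath:
  assumes C: "ecycle C" and e: "e \<in> C"
  obtains p where "spath (h e) p (t e)" "set p = C - {e}"
proof -
  have "h e \<in> ends C" "t e \<in> ends C" using e by (auto simp: ends_def)
  then have "(h e, t e) \<in> (adj C)\<^sup>*" using ecycle_conn[OF C] by (auto simp: conn_def)
  then obtain p where p: "spath (h e) p (t e)" "set p \<subseteq> C" using ex_spath by blast
  have "e \<notin> set p" using spath_tails[OF p(1)] by blast
  then have "distinct (e # p)" using spath_distinct[OF p(1)] by simp
  moreover have "walk (t e) (e # p) (t e)" using p(1) by (simp add: spath_def)
  ultimately have "balanced (set (e # p))" using walk_balanced by blast
  then have "set (e # p) = C" using ecycle_minimal[OF C] p(2) e by simp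
  then have "set p = C - {e}" using \<open>e \<notin> set p\<close> by auto
  then show thesis using that p(1) by blast
qed

text \<open>For a balanced \<open>Y\<close> inside, either \<open>Y\<close> or its complement avoids
  \<open>e\<close> and thus lies on the path, which contains no nonempty balanced set.\<close>

lemma spath_ecycle:
  assumes p: "spath (h e) p (t e)" shows "ecycle (insert e (set p))"
proof -
  let ?C = "insert e (set p)"
  have "e \<notin> set p" using spath_tails[OF p] by blast
  then have "distinct (e # p)" using spath_distinct[OF p] by simp
  moreover have "walk (t e) (e # p) (t e)" using p by (simp add: spath_def)
  ultimately have bal: "balanced ?C" using walk_balanced[of _ "e # p"] by simp
  show ?thesis
    unfolding ecycle_def
  proof (intro conjI bal allI impI)
    fix Y assume Y: "Y \<subseteq> ?C" "balanced Y"
    show "Y = {} \<or> Y = ?C"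
    proof (cases "e \<in> Y")
      case True
      then have "?C - Y \<subseteq> set p" by auto
      then have "?C - Y = {}"
        using spath_acyclic[OF p balanced_Diff[OF bal Y(2,1)]] by simp
      then show ?thesis using Y(1) by blast
    next
      case False
      then show ?thesis using spath_acyclic[OF p Y(2)] Y(1) by blast
    qed
  qed simp
qed

text \<open>Removing \<open>e\<close> leaves a path that ends in \<open>t e\<close>, and a simple
  path has no arc leaving its last vertex.\<close>

lemma ecycle_inj_tail: assumes "ecycle C" shows "inj_on t C"
proof (rule inj_onI)
  fix e e' assume e: "e \<in> C" and e': "e' \<in> C" "t e = t e'"
  obtain p where p: "spath (h e) p (t e)" "set p = C - {e}" using ecycle_spath[OF assms e] .
  show "e = e'"
  proof (rule ccontr)
    assume "e \<noteq> e'"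
    then have "e' \<in> set p" using e' p(2) by simp
    then have "t e' \<in> t ` set p" by (rule imageI)
    then show False using spath_tails[OF p(1)] e'(2) by simp
  qed
qed

lemma ecycle_inj_head: assumes "ecycle C" shows "inj_on h C"
proof (rule inj_onI)
  fix e e' assume e: "e \<in> C" and e': "e' \<in> C" "h e = h e'"
  obtain p where p: "spath (h e) p (t e)" "set p = C - {e}" using ecycle_spath[OF assms e] .
  show "e = e'"
  proof (rule ccontr)
    assume "e \<noteq> e'"
    then have "e' \<in> set p" using e' p(2) by simp
    then have "h e' \<in> h ` set p" by (rule imageI)
    then show False using p(1) e'(2) by (simp add: spath_def)
  qed
qed

lemma ecycle_card: "ecycle C \<Longrightarrow> card (ends C) = card C"
  by (simp add: balanced_ends(1) ecycle_balanced card_image ecycle_inj_tail)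

section \<open>Cactus digraphs\<close>

definition ecycles :: "'b set \<Rightarrow> 'b set set" where
  "ecycles F = {C. C \<subseteq> F \<and> ecycle C}"

definition cactus :: "'b set \<Rightarrow> bool" where
  "cactus F \<longleftrightarrow> (\<forall>C\<in>ecycles F. \<forall>C'\<in>ecycles F. C \<inter> C' \<noteq> {} \<longrightarrow> C = C')"

lemma finite_ecycles: "finite F \<Longrightarrow> finite (ecycles F)"
  by (rule finite_subset[of _ "Pow F"]) (auto simp: ecycles_def)

lemma cactusD:
  "cactus F \<Longrightarrow> ecycle C \<Longrightarrow> C \<subseteq> F \<Longrightarrow> ecycle C' \<Longrightarrow> C' \<subseteq> F \<Longrightarrow> e \<in> C \<Longrightarrow> e \<in> C' \<Longrightarrow> C = C'"
  by (auto simp: cactus_def ecycles_def)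

lemma cactus_subset: "cactus F \<Longrightarrow> K \<subseteq> F \<Longrightarrow> cactus K"
  unfolding cactus_def ecycles_def by blast

lemma ecycles_ecycle: "ecycle X \<Longrightarrow> ecycles X = {X}"
  using ecycle_balanced ecycle_nonempty ecycle_minimal unfolding ecycles_def by blast

text \<open>
  Two distinct vertices of \<open>X\<close> joined outside \<open>X\<close> would give a cycle that shares an arc with
  \<open>X\<close> but misses another one.
\<close>
lemma cactus_component_meets_once:
  assumes cac: "cactus F" and X: "ecycle X" "X \<subseteq> F"
    and v: "v \<in> ends X" and w: "w \<in> ends X" and vw: "(v, w) \<in> (adj (F - X))\<^sup>*"
  shows "v = w"
proof (rule ccontr)
  assume neq: "v \<noteq> w"
  obtain p where p: "spath v p w" "set p \<subseteq> F - X" using ex_spath[OF vw] by blast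
  have "(w, v) \<in> (adj X)\<^sup>*" using ecycle_conn[OF X(1)] v w by (auto simp: conn_def)
  then obtain q where q: "spath w q v" "set q \<subseteq> X" using ex_spath by blast
  have "flow (\<lambda>_. 1) (set p \<union> set q) x = 0" for x
    using p q spath_flow[OF p(1), of x] spath_flow[OF q(1), of x]
    by (subst flow_Un_disjoint) auto
  then have bal: "balanced (set p \<union> set q)" by (simp add: balanced_def)
  obtain e where e: "e \<in> set q" using q(1) neq by (cases q) (auto simp: spath_Nil)
  then obtain Z where Z: "ecycle Z" "e \<in> Z" "Z \<subseteq> set p \<union> set q"
    using arc_in_ecycle[OF bal] by blast
  moreover have "Z \<subseteq> F" using Z(3) p(2) q(2) X(2) by blast
  ultimately have "Z = X" using cactusD[OF cac Z(1) _ X, of e] e q(2) by blast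
  then have "X \<subseteq> set q" using Z(3) p(2) by blast
  then show False
    using spath_acyclic[OF q(1) ecycle_balanced[OF X(1)]] ecycle_nonempty[OF X(1)] by blast
qed

text \<open>For consecutive arcs \<open>a\<close> and \<open>b\<close> of \<open>X\<close>, the part
  of \<open>F - X\<close> attached to \<open>h a\<close> has only \<open>a\<close> entering and only
  \<open>b\<close> leaving, so conservation gives \<open>f a = f b\<close>; minimality of
  \<open>X\<close> spreads the value around the cycle.\<close>

lemma cactus_circulation_const:
  assumes F: "balanced F" "cactus F" and f: "\<And>v. flow f F v = 0"
    and X: "ecycle X" "X \<subseteq> F" and e0: "e0 \<in> X" and e1: "e1 \<in> X"
  shows "f e1 = f e0"
proof -
  have fin: "finite F" using F(1) balanced_finite by blast
  have step: "f b = f a" if a: "a \<in> X" and b: "b \<in> X" and ab: "t b = h a" for a b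
  proof -
    define S where "S = (adj (F - X))\<^sup>* `` {h a}"
    have bal: "balanced (F - X)" using balanced_Diff F(1) ecycle_balanced[OF X(1)] X(2) by blast
    have iff: "v \<in> S \<longleftrightarrow> v = h a" if "v \<in> ends X" for v
      using cactus_component_meets_once[OF F(2) X, of "h a" v] that a
      by (auto simp: S_def ends_def)
    have cross: "t e \<in> S \<longleftrightarrow> h e \<in> S" if "e \<in> F - X" for e
      using that reach_closed[of e "F - X"] balanced_reach_arc[OF bal that]
      by (auto simp: S_def)
    have tS: "t e \<in> S \<longleftrightarrow> e = b" and hS: "h e \<in> S \<longleftrightarrow> e = a" if "e \<in> X" for e
    proof -
      have "t e \<in> ends X" "h e \<in> ends X" using that by (auto simp: ends_def)
      then show "t e \<in> S \<longleftrightarrow> e = b" "h e \<in> S \<longleftrightarrow> e = a"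
        using iff inj_onD[OF ecycle_inj_tail[OF X(1)]] inj_onD[OF ecycle_inj_head[OF X(1)]]
          that a b ab by metis+
    qed
    have "0 = (\<Sum>e\<in>F. f e * (of_bool (t e \<in> S) - of_bool (h e \<in> S)))"
      using cut_flow[OF fin f] by simp
    also have "\<dots> = (\<Sum>e\<in>X. f e * (of_bool (t e \<in> S) - of_bool (h e \<in> S)))"
      using fin X(2) cross by (intro sum.mono_neutral_right) auto
    also have "\<dots> = (\<Sum>e\<in>X. (if e = b then f e else 0) - (if e = a then f e else 0))"
      using tS hS by (intro sum.cong) auto
    also have "\<dots> = f b - f a"
      using a b ecycle_finite[OF X(1)] by (simp add: sum_subtractf)
    finally show ?thesis by simp
  qed
  \<comment> \<open>The arcs of \<open>X\<close> with the value \<open>f e0\<close>, described by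
    their tails to fit \<open>balanced_closed_part\<close>; \<open>step\<close> shows that this tail
    set is closed along \<open>X\<close>.\<close>
  let ?Y = "{e \<in> X. t e \<in> t ` {e \<in> X. f e = f e0}}"
  have "balanced ?Y"
  proof (rule balanced_closed_part[OF ecycle_balanced[OF X(1)]])
    fix e assume e: "e \<in> X" "t e \<in> t ` {e \<in> X. f e = f e0}"
    then have "f e = f e0" using inj_onD[OF ecycle_inj_tail[OF X(1)]] by fastforce
    moreover obtain b where "b \<in> X" "t b = h e"
      using balanced_following_arc[OF ecycle_balanced[OF X(1)] e(1)] by blast
    ultimately show "h e \<in> t ` {e \<in> X. f e = f e0}"
      using step[OF e(1)] by force
  qed
  moreover have "?Y \<noteq> {}" using e0 by blast
  ultimately have "?Y = X" using ecycle_minimal[OF X(1)] by blast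
  then have "t e1 \<in> t ` {e \<in> X. f e = f e0}" using e1 by blast
  then show ?thesis using inj_onD[OF ecycle_inj_tail[OF X(1)]] e1 by fastforce
qed

text \<open>The difference of the indicators of two paths with common ends is a circulation. On an
  arc only in \<open>p\<close> it is 1, hence 1 on a whole cycle through that arc, and this cycle
  would lie inside the simple path \<open>p\<close>.\<close>

lemma cactus_spath_subset:
  assumes F: "balanced F" "cactus F"
    and p: "spath u p v" "set p \<subseteq> F" and q: "spath u q v" "set q \<subseteq> F"
  shows "set p \<subseteq> set q"
proof
  fix e assume e: "e \<in> set p"
  show "e \<in> set q"
  proof (rule ccontr)
    assume nq: "e \<notin> set q"
    define f :: "'b \<Rightarrow> int" where "f a = of_bool (a \<in> set p) - of_bool (a \<in> set q)" for a
    have fin: "finite F" using F(1) balanced_finite by blast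
    have ind: "flow (\<lambda>a. of_bool (a \<in> set r)) F x = flow (\<lambda>_. 1) (set r) x"
      if "set r \<subseteq> F" for r x
      unfolding flow_def using fin that by (intro sum.mono_neutral_cong_right) auto
    have "flow f F x = flow (\<lambda>_. 1) (set p) x - flow (\<lambda>_. 1) (set q) x" for x
      unfolding ind[OF p(2), symmetric] ind[OF q(2), symmetric]
      by (simp add: flow_def f_def left_diff_distrib sum_subtractf)
    then have "flow f F x = 0" for x
      using spath_flow[OF p(1), of x] spath_flow[OF q(1), of x] by simp
    moreover obtain X where X: "ecycle X" "e \<in> X" "X \<subseteq> F"
      using arc_in_ecycle[OF F(1)] e p(2) by blast
    ultimately have const: "f a = f e" if "a \<in> X" for a
      using cactus_circulation_const[OF F] that by blast
    have "X \<subseteq> set p"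
    proof
      fix a assume "a \<in> X"
      then show "a \<in> set p"
        using const[of a] e nq by (cases "a \<in> set q"; cases "a \<in> set p") (auto simp: f_def)
    qed
    then show False
      using spath_acyclic[OF p(1) ecycle_balanced[OF X(1)]] X(2) by blast
  qed
qed


section \<open>Splitting a digraph at a vertex\<close>

text \<open>
  Any component of \<open>F - X\<close> will do as \<open>K\<close>: all of them touch \<open>X\<close>, since \<open>F\<close> is
  connected.
\<close>
lemma split_off_component:
  assumes F: "balanced F" "conn F" and X: "ecycle X" "X \<subset> F"
  obtains K where "K \<noteq> {}" "K \<subseteq> F - X" "balanced K" "conn K" "balanced (F - K)" "conn (F - K)"
    "ends K \<inter> ends (F - K) = ends K \<inter> ends X" "ends K \<inter> ends X \<noteq> {}"
proof -
  define G where "G = F - X"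
  have balG: "balanced G"
    unfolding G_def using balanced_Diff[OF F(1) ecycle_balanced[OF X(1)]] X(2) by blast
  have in_comp: "v \<in> ends (component G (t a)) \<longleftrightarrow> (t a, v) \<in> (adj G)\<^sup>*" if "a \<in> G" for a v
    using ends_component[OF balG, of "t a"] that by (auto simp: ends_def)
  \<comment> \<open>If no vertex of the component lay on \<open>X\<close>, a walk in
    \<open>F\<close> from it could never use an arc of \<open>X\<close> and would stay inside; but
    \<open>F\<close> is connected and contains \<open>X\<close>.\<close>
  have touch: "\<exists>x\<in>ends X. x \<in> ends (component G (t a))" if a: "a \<in> G" for a
  proof (rule ccontr)
    assume no: "\<not> ?thesis"
    have stay: "(t a, v) \<in> (adj G)\<^sup>*" if "(t a, v) \<in> (adj F)\<^sup>*" for v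
      using that
    proof (induction rule: rtrancl_induct)
      case (step y z)
      then obtain e where e: "e \<in> F" "y = t e" "z = h e" unfolding adj_def by blast
      have "e \<notin> X"
      proof
        assume "e \<in> X"
        then have "t e \<in> ends X" by (simp add: ends_def)
        then show False using no in_comp[OF a] step.IH e(2) by blast
      qed
      then have "e \<in> G" using e by (simp add: G_def)
      then show ?case using reach_closed[of e G] step.IH e by simp
    qed simp
    obtain x where x: "x \<in> X" using ecycle_nonempty[OF X(1)] by blast
    then have "(t a, t x) \<in> (adj F)\<^sup>*"
      using F(2) a X(2) by (auto simp: conn_def ends_def G_def)
    then have "t x \<in> ends (component G (t a))" using stay in_comp[OF a] by blast
    moreover have "t x \<in> ends X" using x by (simp add: ends_def)
    ultimately show False using no by blast
  qed
  obtain e where e: "e \<in> G" using X(2) by (auto simp: G_def)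
  define K where "K = component G (t e)"
  have KG: "K \<subseteq> G" unfolding K_def by (rule component_subset)
  have balK: "balanced K" and connK: "conn K"
    unfolding K_def using balanced_component conn_component balG by blast+
  have balFK: "balanced (F - K)" using balanced_Diff[OF F(1) balK] KG by (auto simp: G_def)
  have K_closed: "a \<in> K" if a: "a \<in> G" and v: "v = t a \<or> v = h a" "v \<in> ends K" for a v
  proof -
    have "(t e, v) \<in> (adj G)\<^sup>*" using in_comp[OF e] v(2) by (simp add: K_def)
    moreover have "(v, t a) \<in> (adj G)\<^sup>*" using v(1) balanced_reach_arc[OF balG a] by auto
    ultimately have "(t e, t a) \<in> (adj G)\<^sup>*" by (rule rtrancl_trans)
    then show ?thesis using a by (simp add: K_def component_def)
  qed
  obtain x0 where x0: "x0 \<in> X" using ecycle_nonempty[OF X(1)] by blast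
  have XFK: "X \<subseteq> F - K" using X(2) KG by (auto simp: G_def)
  have X_reach: "(t x0, x) \<in> (adj (F - K))\<^sup>*" if "x \<in> ends X" for x
    using ecycle_conn[OF X(1)] that x0 reach_mono[OF _ XFK] by (auto simp: conn_def ends_def)
  \<comment> \<open>Every remaining component of \<open>F - X\<close> touches \<open>X\<close> and
    avoids \<open>K\<close>, so \<open>X\<close> links all of \<open>F - K\<close>.\<close>
  have connFK: "conn (F - K)"
  proof (rule balanced_connI[OF balFK])
    fix a assume a: "a \<in> F - K"
    show "(t x0, t a) \<in> (adj (F - K))\<^sup>*"
    proof (cases "a \<in> X")
      case True
      then show ?thesis using X_reach by (auto simp: ends_def)
    next
      case False
      then have aG: "a \<in> G" using a by (simp add: G_def)
      obtain x where x: "x \<in> ends X" "x \<in> ends (component G (t a))" using touch[OF aG] by blast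
      have sub: "component G (t a) \<subseteq> F - K"
      proof
        fix b assume b: "b \<in> component G (t a)"
        have "b \<notin> K"
        proof
          assume "b \<in> K"
          then have "(t e, t b) \<in> (adj G)\<^sup>*" by (simp add: K_def component_def)
          moreover have "(t b, t a) \<in> (adj G)\<^sup>*"
            using b balanced_reach_sym[OF balG] by (simp add: component_def)
          ultimately have "(t e, t a) \<in> (adj G)\<^sup>*" by (rule rtrancl_trans)
          then show False using a aG by (simp add: K_def component_def)
        qed
        then show "b \<in> F - K" using b component_subset[of G] by (auto simp: G_def)
      qed
      have "(t a, x) \<in> (adj (component G (t a)))\<^sup>*"
        using in_comp[OF aG] x(2) reach_component by blast
      then have "(x, t a) \<in> (adj (component G (t a)))\<^sup>*"
        by (rule balanced_reach_sym[OF balanced_component[OF balG]])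
      then show ?thesis using X_reach[OF x(1)] reach_mono[OF _ sub] by (meson rtrancl_trans)
    qed
  qed
  have "ends K \<inter> ends (F - K) \<subseteq> ends X"
  proof
    fix v assume v: "v \<in> ends K \<inter> ends (F - K)"
    then obtain a where a: "a \<in> F - K" "v = t a \<or> v = h a" by (auto simp: ends_def)
    then have "a \<notin> G" using K_closed v by blast
    then have "a \<in> X" using a(1) by (simp add: G_def)
    then show "v \<in> ends X" using a(2) by (auto simp: ends_def)
  qed
  then have int: "ends K \<inter> ends (F - K) = ends K \<inter> ends X" using ends_mono[OF XFK] by blast
  have "ends K \<inter> ends X \<noteq> {}" using touch[OF e] by (auto simp: K_def)
  moreover have "K \<noteq> {}" using component_arc[OF e] by (auto simp: K_def)
  ultimately show thesis
    using that KG balK connK balFK connFK int unfolding G_def by blast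
qed

text \<open>Away from \<open>x\<close> each vertex has arcs of \<open>Z\<close> on at most one side,
  so \<open>Z \<inter> K\<close> is conserved there; as net flows sum to 0, it is conserved at
  \<open>x\<close> as well. Minimality of \<open>Z\<close> then leaves only one side.\<close>

lemma ecycle_in_amalgam:
  assumes fin: "finite K" "finite L" and KL: "K \<inter> L = {}" "ends K \<inter> ends L \<subseteq> {x}"
    and Z: "ecycle Z" "Z \<subseteq> K \<union> L"
  shows "Z \<subseteq> K \<or> Z \<subseteq> L"
proof -
  let ?f = "flow (\<lambda>_. 1)"
  have sum: "?f (Z \<inter> K) v + ?f (Z \<inter> L) v = 0" for v
  proof -
    have "?f (Z \<inter> K \<union> Z \<inter> L) v = ?f (Z \<inter> K) v + ?f (Z \<inter> L) v"
      using fin KL(1) by (intro flow_Un_disjoint) auto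
    moreover have "Z \<inter> K \<union> Z \<inter> L = Z" using Z(2) by blast
    ultimately show ?thesis using ecycle_balanced[OF Z(1)] by (simp add: balanced_def)
  qed
  have away: "?f (Z \<inter> K) v = 0" if "v \<noteq> x" for v
  proof -
    have "v \<notin> ends (Z \<inter> K) \<or> v \<notin> ends (Z \<inter> L)"
      using that KL(2) ends_mono[of "Z \<inter> K" K] ends_mono[of "Z \<inter> L" L] by blast
    then show ?thesis using sum[of v] flow_notin by fastforce
  qed
  have "?f (Z \<inter> K) x = 0"
  proof -
    let ?V = "insert x (ends (Z \<inter> K))"
    have finV: "finite ?V" using fin finite_ends by blast
    have "(\<Sum>v\<in>?V. ?f (Z \<inter> K) v)
        = (\<Sum>e\<in>Z \<inter> K. \<Sum>v\<in>?V. of_bool (t e = v) - of_bool (h e = v))"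
      by (simp only: flow_def mult_1_left) (rule sum.swap)
    also have "\<dots> = 0"
    proof (rule sum.neutral, rule ballI)
      fix e assume "e \<in> Z \<inter> K"
      then have "t e \<in> ?V" "h e \<in> ?V" by (auto simp: ends_def)
      then show "(\<Sum>v\<in>?V. of_bool (t e = v) - of_bool (h e = v)) = (0 :: int)"
        using finV by (simp add: sum_subtractf of_bool_def)
    qed
    also have "(\<Sum>v\<in>?V. ?f (Z \<inter> K) v) = ?f (Z \<inter> K) x + (\<Sum>v\<in>?V - {x}. ?f (Z \<inter> K) v)"
      using finV by (intro sum.remove) auto
    also have "(\<Sum>v\<in>?V - {x}. ?f (Z \<inter> K) v) = 0"
      using away by (intro sum.neutral) auto
    finally show ?thesis by simp
  qed
  then have "?f (Z \<inter> K) v = 0" for v using away by (cases "v = x") auto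
  then have "balanced (Z \<inter> K)" using fin by (simp add: balanced_def)
  then have "Z \<inter> K = {} \<or> Z \<inter> K = Z" using Z(1) by (auto simp: ecycle_def)
  then show ?thesis using Z(2) by blast
qed

lemma ecycles_amalgam:
  assumes "finite K" "finite L" "K \<inter> L = {}" "ends K \<inter> ends L \<subseteq> {x}"
  shows "ecycles (K \<union> L) = ecycles K \<union> ecycles L"
  using ecycle_in_amalgam[OF assms] unfolding ecycles_def by blast

lemma ecycles_disjoint: "K \<inter> L = {} \<Longrightarrow> ecycles K \<inter> ecycles L = {}"
  using ecycle_nonempty by (fastforce simp: ecycles_def)

lemma cactus_amalgam:
  assumes "finite K" "finite L" "K \<inter> L = {}" "ends K \<inter> ends L \<subseteq> {x}"
    and "cactus K" "cactus L"
  shows "cactus (K \<union> L)"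
  unfolding cactus_def ecycles_amalgam[OF assms(1-4)]
proof (intro ballI impI)
  fix C C' assume C: "C \<in> ecycles K \<union> ecycles L" "C' \<in> ecycles K \<union> ecycles L" "C \<inter> C' \<noteq> {}"
  have "C \<subseteq> K \<and> C' \<subseteq> L \<or> C \<subseteq> L \<and> C' \<subseteq> K \<Longrightarrow> False"
    using C(3) assms(3) by blast
  then show "C = C'" using C assms(5,6) unfolding cactus_def ecycles_def by blast
qed

text \<open>A path in \<open>K\<close> from \<open>v\<close> to the first other interface vertex is
  closed up through \<open>X\<close>. The last conclusion lets \<open>v\<close> be recovered from
  \<open>Z\<close>, so different interface vertices give different cycles.\<close>

lemma crossing_ecycle:
  assumes K: "balanced K" "conn K" and X: "ecycle X" and KX: "K \<inter> X = {}"
    and v: "v \<in> ends K \<inter> ends X" and w: "w \<in> ends K \<inter> ends X" "w \<noteq> v"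
  shows "\<exists>Z. ecycle Z \<and> Z \<subseteq> K \<union> X \<and> \<not> Z \<subseteq> K \<and> t ` {e \<in> Z \<inter> K. t e \<in> ends K \<inter> ends X} = {v}"
proof -
  let ?I = "ends K \<inter> ends X"
  have "(v, w) \<in> (adj K)\<^sup>*" using K(2) v w by (auto simp: conn_def)
  then obtain p0 where p0: "spath v p0 w" "set p0 \<subseteq> K" using ex_spath by blast
  obtain p w' where p: "spath v p w'" "set p \<subseteq> set p0" "w' \<in> ?I - {v}" "t ` set p \<inter> (?I - {v}) = {}"
    using spath_first_hit[OF p0(1), of "?I - {v}"] w by blast
  have pK: "set p \<subseteq> K" using p(2) p0(2) by blast
  have "(w', v) \<in> (adj X)\<^sup>*" using ecycle_conn[OF X] v p(3) by (auto simp: conn_def)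
  then obtain q where q: "spath w' q v" "set q \<subseteq> X" using ex_spath by blast
  obtain e p' where e: "p = e # p'" using p(1,3) by (cases p) (auto simp: spath_Nil)
  have te: "t e = v" using p(1) e by (simp add: spath_Cons)
  have "flow (\<lambda>_. 1) (set p \<union> set q) x = 0" for x
    using pK q(2) KX spath_flow[OF p(1), of x] spath_flow[OF q(1), of x]
    by (subst flow_Un_disjoint) auto
  then have bal: "balanced (set p \<union> set q)" by (simp add: balanced_def)
  \<comment> \<open>Any cycle through the first arc \<open>e\<close> will do: \<open>p\<close> is
    acyclic, so the cycle cannot stay in \<open>K\<close>, and \<open>v\<close> is the only
    interface vertex that \<open>p\<close> leaves.\<close>
  obtain Z where Z: "ecycle Z" "e \<in> Z" "Z \<subseteq> set p \<union> set q"
    using arc_in_ecycle[OF bal, of e] e by auto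
  have "\<not> Z \<subseteq> K"
  proof
    assume "Z \<subseteq> K"
    then have "Z \<subseteq> set p" using Z(3) q(2) KX by blast
    then show False
      using spath_acyclic[OF p(1) ecycle_balanced[OF Z(1)]] ecycle_nonempty[OF Z(1)] by blast
  qed
  moreover have "t ` {a \<in> Z \<inter> K. t a \<in> ?I} = {v}"
  proof
    show "t ` {a \<in> Z \<inter> K. t a \<in> ?I} \<subseteq> {v}" using Z(3) q(2) KX p(4) by blast
    have "e \<in> {a \<in> Z \<inter> K. t a \<in> ?I}" using Z(2) e pK te v by auto
    then show "{v} \<subseteq> t ` {a \<in> Z \<inter> K. t a \<in> ?I}" using te by blast
  qed
  moreover have "Z \<subseteq> K \<union> X" using Z(3) pK q(2) by blast
  ultimately show ?thesis using Z(1) by blast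
qed

text \<open>
  If the split-off component \<open>K\<close> meets the rest in \<open>s > 1\<close> vertices, then \<open>s - 1\<close> further
  cycles are needed for the bound, but each of these vertices provides a cycle crossing between
  \<open>K\<close> and the rest.
\<close>
lemma card_ecycles:
  assumes "balanced F" "conn F" "F \<noteq> {}"
  shows "card F + 1 \<le> card (ecycles F) + card (ends F) \<and>
    (card F + 1 = card (ecycles F) + card (ends F) \<longleftrightarrow> cactus F)"
  using balanced_finite[OF assms(1)] assms
proof (induction F rule: finite_psubset_induct)
  case (psubset F)
  have fin: "finite F" by (rule psubset.hyps)
  obtain X where X: "ecycle X" "X \<subseteq> F" using ex_ecycle psubset.prems by blast
  show ?case
  proof (cases "X = F")
    case True
    then have "ecycles F = {F}" "card (ends F) = card F"
      using X(1) ecycles_ecycle ecycle_card by auto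
    then show ?thesis by (simp add: cactus_def)
  next
    case False
    then have XF: "X \<subset> F" using X(2) by blast
    obtain K where K: "K \<noteq> {}" "K \<subseteq> F - X" "balanced K" "conn K" "balanced (F - K)" "conn (F - K)"
      and int: "ends K \<inter> ends (F - K) = ends K \<inter> ends X" and ne: "ends K \<inter> ends X \<noteq> {}"
      by (rule split_off_component[OF psubset.prems(1,2) X(1) XF])
    let ?I = "ends K \<inter> ends X"
    have L: "F - K \<noteq> {}" "F - K \<subset> F" "K \<subset> F" using K(1,2) X ecycle_nonempty by blast+
    have U: "K \<union> (F - K) = F" "K \<inter> (F - K) = {}" using L by blast+
    have finKL: "finite K" "finite (F - K)" using fin L finite_subset by blast+
    note IHK = psubset.IH[OF L(3) K(3,4,1)] and IHL = psubset.IH[OF L(2) K(5,6) L(1)]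
    have cardF: "card F = card K + card (F - K)"
      using card_Un_disjoint[OF finKL U(2)] U(1) by simp
    have cardV: "card (ends F) + card ?I = card (ends K) + card (ends (F - K))"
      using card_Un_Int[OF finite_ends[OF finKL(1)] finite_ends[OF finKL(2)]]
        ends_Un[of K "F - K"] U(1) int by simp
    have finE: "finite (ecycles K)" "finite (ecycles (F - K))"
      using finKL finite_ecycles by blast+
    have cardE: "card (ecycles K \<union> ecycles (F - K)) = card (ecycles K) + card (ecycles (F - K))"
      using card_Un_disjoint[OF finE ecycles_disjoint[OF U(2)]] .
    have finI: "finite ?I" using finite_ends[OF finKL(1)] by blast
    show ?thesis
    proof (cases "card ?I = 1")
      \<comment> \<open>With one common vertex, arcs and cycles add up and vertices add up to one
        too many, so the bound and its equality case both carry over.\<close>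
      case True
      then obtain x where x: "?I = {x}" using card_1_singletonE by blast
      have "ecycles F = ecycles K \<union> ecycles (F - K)"
        using ecycles_amalgam[OF finKL U(2), of x] x int U(1) by simp
      moreover have "cactus F \<longleftrightarrow> cactus K \<and> cactus (F - K)"
        using cactus_amalgam[OF finKL U(2), of x] x int U(1)
          cactus_subset[of F K] cactus_subset[of F "F - K"] L by auto
      ultimately show ?thesis using IHK IHL cardF cardV cardE True by auto
    next
      case False
      then have big: "card ?I \<ge> 2" using ne finI
        by (metis Suc_1 Suc_leI card_gt_0_iff le_neq_implies_less One_nat_def)
      have other: "\<exists>w. w \<in> ?I \<and> w \<noteq> v" for v
      proof (rule ccontr)
        assume "\<not> ?thesis"
        then have "?I \<subseteq> {v}" by blast
        then have "card ?I \<le> 1" using card_mono[of "{v}" ?I] by simp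
        then show False using big by simp
      qed
      have KX: "K \<inter> X = {}" using K(2) by blast
      have "\<forall>v\<in>?I. \<exists>Z. ecycle Z \<and> Z \<subseteq> K \<union> X \<and> \<not> Z \<subseteq> K \<and> t ` {e \<in> Z \<inter> K. t e \<in> ?I} = {v}"
      proof
        fix v assume v: "v \<in> ?I"
        obtain w where w: "w \<in> ?I" "w \<noteq> v" using other by blast
        show "\<exists>Z. ecycle Z \<and> Z \<subseteq> K \<union> X \<and> \<not> Z \<subseteq> K \<and> t ` {e \<in> Z \<inter> K. t e \<in> ?I} = {v}"
          by (rule crossing_ecycle[OF K(3,4) X(1) KX v w])
      qed
      from bchoice[OF this] obtain Z where Z: "\<And>v. v \<in> ?I \<Longrightarrow>
          ecycle (Z v) \<and> Z v \<subseteq> K \<union> X \<and> \<not> Z v \<subseteq> K \<and> t ` {e \<in> Z v \<inter> K. t e \<in> ?I} = {v}"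
        by blast
      have inj: "inj_on Z ?I"
      proof (rule inj_onI)
        fix v w assume vw: "v \<in> ?I" "w \<in> ?I" "Z v = Z w"
        then have "{v} = {w}" using Z by metis
        then show "v = w" by simp
      qed
      have disj: "Z ` ?I \<inter> (ecycles K \<union> ecycles (F - K)) = {}"
      proof -
        have "Z v \<notin> ecycles K \<union> ecycles (F - K)" if "v \<in> ?I" for v
        proof -
          have "{e \<in> Z v \<inter> K. t e \<in> ?I} \<noteq> {}" using Z[OF that] by (metis image_empty insert_not_empty)
          then have "\<not> Z v \<subseteq> F - K" by blast
          then show ?thesis using Z[OF that] by (simp add: ecycles_def)
        qed
        then show ?thesis by blast
      qed
      have sub: "Z ` ?I \<union> (ecycles K \<union> ecycles (F - K)) \<subseteq> ecycles F"
      proof -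
        have "Z v \<in> ecycles F" if "v \<in> ?I" for v
          using Z[OF that] K(2) X(2) by (auto simp: ecycles_def)
        moreover have "ecycles K \<union> ecycles (F - K) \<subseteq> ecycles F"
          using L by (auto simp: ecycles_def)
        ultimately show ?thesis by blast
      qed
      have "card (Z ` ?I \<union> (ecycles K \<union> ecycles (F - K))) =
          card ?I + (card (ecycles K) + card (ecycles (F - K)))"
        using card_Un_disjoint[OF finite_imageI[OF finI] finite_UnI[OF finE] disj]
          card_image[OF inj] cardE by simp
      then have "card ?I + (card (ecycles K) + card (ecycles (F - K))) \<le> card (ecycles F)"
        using card_mono[OF finite_ecycles[OF fin] sub] by simp
      \<comment> \<open>The two bounds add up to \<open>card F + 2\<close> on the left and count the
        interface twice on the right; the crossing cycles make up for the double count, which leaves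
        a surplus of one.\<close>
      then have strict: "card F + 1 < card (ecycles F) + card (ends F)"
        using IHK IHL cardF cardV by linarith
      \<comment> \<open>Since \<open>K\<close> is connected and avoids \<open>X\<close>, two
        interface vertices are joined outside \<open>X\<close>.\<close>
      have "\<not> cactus F"
      proof
        assume cac: "cactus F"
        obtain v w where vw: "v \<in> ?I" "w \<in> ?I" "w \<noteq> v"
          using ne other by blast
        then have "(v, w) \<in> (adj K)\<^sup>*" using K(4) by (simp add: conn_def)
        then have "(v, w) \<in> (adj (F - X))\<^sup>*" using reach_mono K(2) by blast
        then show False using cactus_component_meets_once[OF cac X] vw by blast
      qed
      then show ?thesis using strict by linarith
    qed
  qed
qed


section \<open>Circuits as lists of arcs\<close>

lemma walk_append: "walk u (p @ q) v \<longleftrightarrow> (\<exists>w. walk u p w \<and> walk w q v)"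
  by (induction p arbitrary: u) auto

lemma walk_reach: "walk u p v \<Longrightarrow> set p \<subseteq> X \<Longrightarrow> e \<in> set p \<Longrightarrow> (u, t e) \<in> (adj X)\<^sup>*"
proof (induction p arbitrary: u)
  case (Cons a p)
  show ?case
  proof (cases "e = a")
    case False
    then have "(h a, t e) \<in> (adj X)\<^sup>*" using Cons by auto
    moreover have "(u, h a) \<in> (adj X)\<^sup>*" using Cons.prems arc_reach by auto
    ultimately show ?thesis by (meson rtrancl_trans)
  qed (use Cons.prems in auto)
qed simp

text \<open>Tails are distinct along a simple path, so the current vertex determines the next arc
  and the order can be read off the set.\<close>

lemma spath_set_inj: "spath u p v \<Longrightarrow> spath u q v \<Longrightarrow> set p = set q \<Longrightarrow> p = q"
proof (induction p arbitrary: u q)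
  case (Cons e p)
  then obtain a q' where q: "q = a # q'" by (cases q) auto
  have "e \<in> set q" using Cons.prems(3) by auto
  moreover have "t e = t a" using Cons.prems(1,2) q by (simp add: spath_Cons)
  ultimately have ea: "e = a"
    using inj_onD[of t "set q" e a] spath_tails[OF Cons.prems(2)] q by simp
  have "e \<notin> set p" "a \<notin> set q'"
    using spath_distinct[OF Cons.prems(1)] spath_distinct[OF Cons.prems(2)] q by auto
  then have "set p = set q'" using Cons.prems(3) q ea by auto
  then have "p = q'" using Cons.IH[of "h e" q'] Cons.prems(1,2) q ea by (simp add: spath_Cons)
  then show ?case using q ea by simp
qed simp

end

section \<open>Cycles of a digraph as minimal balanced sets\<close>

sublocale pre_digraph \<subseteq> incidence "tail G" "head G" .

context pre_digraph begin

lemma cas_eq_walk: "cas u p v \<longleftrightarrow> walk u p v"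
  by (induction p arbitrary: u) auto

lemma awalk_verts_walk: "walk u p v \<Longrightarrow> awalk_verts u p = u # map (head G) p"
  by (induction p arbitrary: u) auto

lemma apath_eq_spath: "apath u p v \<longleftrightarrow> u \<in> verts G \<and> set p \<subseteq> arcs G \<and> spath u p v"
  by (auto simp: apath_def awalk_def cas_eq_walk spath_def awalk_verts_walk)

lemma trail_eq_walk: "trail u p v \<longleftrightarrow> u \<in> verts G \<and> set p \<subseteq> arcs G \<and> walk u p v \<and> distinct p"
  by (auto simp: trail_def awalk_def cas_eq_walk)

lemma cycle_eq_walk: "cycle p \<longleftrightarrow>
    p \<noteq> [] \<and> (\<exists>u\<in>verts G. set p \<subseteq> arcs G \<and> walk u p u \<and> distinct (map (head G) p))"
  by (auto simp: cycle_def awalk_def cas_eq_walk awalk_verts_walk)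

lemma arcs_ends_eq_adj: "arcs_ends G = adj (arcs G)"
  by (simp add: arcs_ends_def arc_to_ends_def adj_def)

lemma rotation_class:
  "closed_trail G p \<Longrightarrow> rotation G `` {p} = range (\<lambda>n. rotate n p)"
  by (auto simp: rotation_def)

lemma circuit_arcs_rotations: "circuit_arcs (range (\<lambda>n. rotate n p)) = set p"
  by (auto simp: circuit_arcs_def)

lemma circuits_eq: "circuits G = {range (\<lambda>n. rotate n p) | p. closed_trail G p}"
  using rotation_class by (fastforce simp: circuits_def quotient_def)

end

context wf_digraph begin

text \<open>The heads along \<open>e # p\<close> are exactly the vertices of the path
  \<open>p\<close> started at \<open>head G e\<close>, so the two distinctness conditions concern
  the same list.\<close>

lemma cycle_Cons:
  "cycle (e # p) \<longleftrightarrow> set (e # p) \<subseteq> arcs G \<and> spath (head G e) p (tail G e)"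
  by (auto simp: cycle_eq_walk spath_def)

lemma cycle_rotate:
  assumes "cycle p" shows "cycle (rotate n p)"
proof -
  have step: "cycle (rotate1 q)" if "cycle q" for q
  proof (cases q)
    case (Cons e r)
    then have r: "set (e # r) \<subseteq> arcs G" "spath (head G e) r (tail G e)"
      using that by (auto simp: cycle_Cons)
    then have "walk (head G e) (r @ [e]) (head G e)" by (simp add: spath_def walk_append)
    moreover have "distinct (map (head G) (r @ [e]))" using r(2) by (auto simp: spath_def)
    ultimately show ?thesis using r(1) Cons unfolding cycle_eq_walk by auto
  qed (use that in simp)
  show ?thesis
    unfolding rotate_def by (induction n) (use assms step in auto)
qed

lemma ecycle_of_cycle: assumes "cycle p" shows "ecycle (set p)"
proof (cases p)
  case (Cons e r)
  then show ?thesis using assms spath_ecycle[of e r] by (simp add: cycle_Cons)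
qed (use assms in \<open>simp add: cycle_def\<close>)

lemma cycle_of_ecycle:
  assumes "ecycle C" "C \<subseteq> arcs G" shows "\<exists>p. cycle p \<and> set p = C"
proof -
  obtain e where e: "e \<in> C" using ecycle_nonempty[OF assms(1)] by blast
  obtain p where p: "spath (head G e) p (tail G e)" "set p = C - {e}"
    using ecycle_spath[OF assms(1) e] .
  then have "set (e # p) = C" using e by auto
  then have "cycle (e # p)" using p(1) assms(2) by (simp add: cycle_Cons)
  then show ?thesis using \<open>set (e # p) = C\<close> by blast
qed

lemma closed_trail_cycle: assumes "cycle p" shows "closed_trail G p"
proof -
  obtain u where "u \<in> verts G" "set p \<subseteq> arcs G" "walk u p u" "distinct (map (head G) p)" "p \<noteq> []"
    using assms by (auto simp: cycle_eq_walk)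
  then show ?thesis by (auto simp: closed_trail_def trail_eq_walk distinct_map)
qed

text \<open>Being a cycle is invariant under rotation, so one representative decides for its whole
  class.\<close>

lemma cycles_eq: "cycles G = {range (\<lambda>n. rotate n p) | p. cycle p}"
proof
  show "cycles G \<subseteq> {range (\<lambda>n. rotate n p) | p. cycle p}"
  proof
    fix c assume c: "c \<in> cycles G"
    then obtain p where p: "c = range (\<lambda>n. rotate n p)" by (auto simp: cycles_def circuits_eq)
    have "rotate 0 p \<in> c" unfolding p by (rule rangeI)
    then have "cycle p" using c by (simp add: cycles_def)
    then show "c \<in> {range (\<lambda>n. rotate n p) | p. cycle p}" using p by blast
  qed
  show "{range (\<lambda>n. rotate n p) | p. cycle p} \<subseteq> cycles G"
    using closed_trail_cycle cycle_rotate by (auto simp: cycles_def circuits_eq)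
qed

text \<open>Rotated to start with the same arc \<open>e\<close>, both lists continue as simple paths
  with equal ends and equal arc sets.\<close>

lemma cycle_unique_up_to_rotation:
  assumes p: "cycle p" and q: "cycle q" and pq: "set p = set q"
  shows "\<exists>n. q = rotate n p"
proof -
  obtain e q' where q': "q = e # q'" using q by (cases q) (auto simp: cycle_def)
  then obtain xs ys where xy: "p = xs @ e # ys" using pq by (metis list.set_intros(1) split_list)
  define p' where "p' = ys @ xs"
  have r: "rotate (length xs) p = e # p'" unfolding xy p'_def by (simp add: rotate_append)
  then have cp: "cycle (e # p')" using cycle_rotate[OF p, of "length xs"] by simp
  have s: "spath (head G e) p' (tail G e)" "spath (head G e) q' (tail G e)"
    using cp q q' by (auto simp: cycle_Cons)
  have "e \<notin> set p'" "e \<notin> set q'"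
    using spath_tails[OF s(1)] spath_tails[OF s(2)] by blast+
  moreover have "set (e # p') = set (e # q')" using pq q' r by (metis set_rotate)
  ultimately have "set p' = set q'" by auto
  then have "p' = q'" using spath_set_inj[OF s] by blast
  then show ?thesis using r q' by metis
qed

text \<open>Together with \<open>inj_on_circuit_arcs\<close>, this is the bijection that turns
  statements about circuits into statements about arc sets, cardinalities included.\<close>

lemma circuit_arcs_cycles: "circuit_arcs ` cycles G = ecycles (arcs G)"
proof
  show "circuit_arcs ` cycles G \<subseteq> ecycles (arcs G)"
  proof
    fix C assume "C \<in> circuit_arcs ` cycles G"
    then obtain p where p: "cycle p" "C = set p" by (auto simp: cycles_eq circuit_arcs_rotations)
    then show "C \<in> ecycles (arcs G)"
      using ecycle_of_cycle[OF p(1)] by (simp add: ecycles_def cycle_eq_walk)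
  qed
  show "ecycles (arcs G) \<subseteq> circuit_arcs ` cycles G"
  proof
    fix C assume "C \<in> ecycles (arcs G)"
    then obtain p where p: "cycle p" "set p = C" using cycle_of_ecycle by (auto simp: ecycles_def)
    then have "range (\<lambda>n. rotate n p) \<in> cycles G" by (auto simp: cycles_eq)
    then show "C \<in> circuit_arcs ` cycles G" using p(2) circuit_arcs_rotations[of p] by blast
  qed
qed

lemma inj_on_circuit_arcs: "inj_on circuit_arcs (cycles G)"
proof (rule inj_onI)
  fix c d assume "c \<in> cycles G" "d \<in> cycles G" and eq: "circuit_arcs c = circuit_arcs d"
  then obtain p q where p: "cycle p" "c = range (\<lambda>n. rotate n p)"
    and q: "cycle q" "d = range (\<lambda>n. rotate n q)" by (auto simp: cycles_eq)
  have pq: "set p = set q" using eq p(2) q(2) by (simp add: circuit_arcs_rotations)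
  have sub: "range (\<lambda>n. rotate n q) \<subseteq> range (\<lambda>n. rotate n p)"
    if "\<exists>n. q = rotate n p" for p q :: "'b list"
    using that by (auto simp: rotate_rotate)
  show "c = d"
    using sub[OF cycle_unique_up_to_rotation[OF p(1) q(1) pq]]
      sub[OF cycle_unique_up_to_rotation[OF q(1) p(1) pq[symmetric]]] p(2) q(2) by blast
qed

text \<open>Closed trails are nonempty by definition, hence the condition on
  \<open>arcs G\<close>.\<close>

lemma eulerian_iff_trail:
  "eulerian G \<longleftrightarrow> arcs G \<noteq> {} \<and> (\<exists>u p. trail u p u \<and> set p = arcs G)"
proof
  assume "eulerian G"
  then show "arcs G \<noteq> {} \<and> (\<exists>u p. trail u p u \<and> set p = arcs G)"
    by (fastforce simp: eulerian_def circuits_eq closed_trail_def circuit_arcs_rotations)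
next
  assume "arcs G \<noteq> {} \<and> (\<exists>u p. trail u p u \<and> set p = arcs G)"
  then obtain u p where p: "trail u p u" "set p = arcs G" "arcs G \<noteq> {}" by blast
  then have "range (\<lambda>n. rotate n p) \<in> circuits G"
    by (auto simp: circuits_eq closed_trail_def)
  then show "eulerian G"
    using circuit_arcs_rotations[of p] p(2) unfolding eulerian_def by metis
qed

end

section \<open>Connected Eulerian digraphs as balanced connected arc sets\<close>

context fin_digraph begin

text \<open>A closed Euler trail gives balance and reachability from its start; conversely, balance
  is equality of in- and outdegrees, so Euler's theorem applies. A connected digraph with arcs has
  no isolated vertices, whence the equation for \<open>verts G\<close>.\<close>

lemma connected_eulerian_iff:
  "connected G \<and> eulerian G \<longleftrightarrow>
    arcs G \<noteq> {} \<and> verts G = ends (arcs G) \<and> balanced (arcs G) \<and> conn (arcs G)"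
proof (intro iffI; elim conjE; intro conjI)
  assume con: "connected G" and eul: "eulerian G"
  obtain u p where up: "trail u p u" "set p = arcs G" and ne: "arcs G \<noteq> {}"
    using eul by (auto simp: eulerian_iff_trail)
  show "arcs G \<noteq> {}" by (rule ne)
  show "verts G = ends (arcs G)" using connected_verts[OF con ne] by (simp add: ends_def)
  show bal: "balanced (arcs G)" using walk_balanced[of u p] up by (simp add: trail_eq_walk)
  show "conn (arcs G)"
    using balanced_connI[OF bal, of u] walk_reach[of u p u "arcs G"] up by (simp add: trail_eq_walk)
next
  assume ne: "arcs G \<noteq> {}" and V: "verts G = ends (arcs G)"
    and bal: "balanced (arcs G)" and conn: "conn (arcs G)"
  show con: "connected G"
  proof (rule connectedI)
    show "verts G \<noteq> {}" using ne V by (simp add: ends_def)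
    fix u v assume "u \<in> verts G" "v \<in> verts G"
    then have "u \<rightarrow>\<^sup>* v"
      using conn V by (simp add: reachable_conv' arcs_ends_eq_adj conn_def)
    then show "u \<rightarrow>\<^sup>*\<^bsub>mk_symmetric G\<^esub> v" by (rule reachable_mk_symmetricI)
  qed
  have "in_degree G v = out_degree G v" for v
  proof -
    have "flow (\<lambda>_. 1) (arcs G) v =
        int (card {e \<in> arcs G. tail G e = v}) - int (card {e \<in> arcs G. head G e = v})"
      by (simp add: flow_def sum_subtractf of_bool_def sum.If_cases Int_def)
    then show ?thesis
      using bal by (simp add: balanced_def in_degree_def out_degree_def in_arcs_def out_arcs_def)
  qed
  then obtain u p where "euler_trail u p u" using closed_euler1[OF con] by blast
  then show "eulerian G" using ne by (auto simp: eulerian_iff_trail euler_trail_def)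
qed

end

context wf_digraph begin

lemma arc_subgraph_eulerian_iff:
  assumes "finite F" "F \<noteq> {}"
  shows "connected (arc_subgraph G F) \<and> eulerian (arc_subgraph G F) \<longleftrightarrow> balanced F \<and> conn F"
proof -
  have "fin_digraph (arc_subgraph G F)"
    using assms by unfold_locales (auto simp: arc_subgraph_def)
  from fin_digraph.connected_eulerian_iff[OF this] show ?thesis
    using assms by (simp add: arc_subgraph_def ends_def)
qed

end

section \<open>One-vertex amalgamation\<close>

text \<open>The vertex equation is part of the induction because amalgams meet in
  \<open>verts\<close>, while \<open>cactus_amalgam\<close> speaks of \<open>ends\<close>.\<close>

lemma cycle_closure_cactus:
  assumes "D \<in> cycle_closure"
  shows "fin_digraph D \<and> loopfree_digraph D \<and> verts D = incidence.ends (tail D) (head D) (arcs D) \<and>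
    incidence.cactus (tail D) (head D) (arcs D)"
  using assms
proof induction
  case (cycle C)
  then obtain c where fin: "fin_digraph C" and lf: "loopfree_digraph C"
    and c: "c \<in> cycles C" "C = arc_subgraph C (circuit_arcs c)" by (auto simp: cycle_digraph_def)
  interpret fin_digraph C by (rule fin)
  have verts: "verts C = ends (arcs C)"
    by (subst c(2), subst (2) c(2)) (simp add: arc_subgraph_def ends_def)
  have "arcs C = circuit_arcs c" by (subst c(2)) (simp add: arc_subgraph_def)
  then have "ecycle (arcs C)" using circuit_arcs_cycles c(1) by (auto simp: ecycles_def)
  then have "cactus (arcs C)" using ecycles_ecycle by (simp add: cactus_def)
  then show ?case using fin lf verts by simp
next
  case (amalgam D1 D2)
  interpret D1: fin_digraph D1 using amalgam.IH by blast
  interpret D2: fin_digraph D2 using amalgam.IH by blast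
  interpret L1: loopfree_digraph D1 using amalgam.IH by blast
  interpret L2: loopfree_digraph D2 using amalgam.IH by blast
  have eq: "tail D2 = tail D1" "head D2 = head D1"
    using amalgam.hyps(3) by (simp_all add: compatible_def)
  obtain x where x: "verts D1 \<inter> verts D2 = {x}" using amalgam.hyps(4) card_1_singletonE by blast
  \<comment> \<open>A common arc would put its two distinct ends into the one-vertex
    intersection.\<close>
  have disj: "arcs D1 \<inter> arcs D2 = {}"
  proof (rule ccontr)
    assume "\<not> ?thesis"
    then obtain e where e: "e \<in> arcs D1" "e \<in> arcs D2" by blast
    have "tail D1 e \<in> verts D1 \<inter> verts D2" "head D1 e \<in> verts D1 \<inter> verts D2"
      using D1.wellformed[OF e(1)] D2.wellformed[OF e(2)] by (simp_all add: eq)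
    then show False using L1.no_loops[OF e(1)] by (simp add: x)
  qed
  have verts: "verts D1 = D1.ends (arcs D1)" "verts D2 = D1.ends (arcs D2)"
    and cac: "D1.cactus (arcs D1)" "D1.cactus (arcs D2)"
    using amalgam.IH eq by auto
  have "D1.cactus (arcs D1 \<union> arcs D2)"
    using D1.cactus_amalgam[OF _ _ disj _ cac, of x] x verts by simp
  moreover have fin: "fin_digraph (Digraph_Component.union D1 D2)"
    by unfold_locales (auto simp: eq[symmetric], auto simp: eq)
  moreover have "loopfree_digraph (Digraph_Component.union D1 D2)"
  proof (intro loopfree_digraph.intro loopfree_digraph_axioms.intro)
    show "wf_digraph (Digraph_Component.union D1 D2)" using fin by (rule fin_digraph.axioms(1))
    fix e assume "e \<in> arcs (Digraph_Component.union D1 D2)"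
    then have "e \<in> arcs D1 \<or> e \<in> arcs D2" by simp
    then have "tail D1 e \<noteq> head D1 e"
      using L1.no_loops[of e] L2.no_loops[of e] by (auto simp only: eq)
    then show "tail (Digraph_Component.union D1 D2) e \<noteq> head (Digraph_Component.union D1 D2) e"
      by simp
  qed
  moreover have "verts D1 \<union> verts D2 = D1.ends (arcs D1 \<union> arcs D2)"
    using verts by (simp add: D1.ends_Un)
  ultimately show ?case by (simp add: Digraph_Component.union_def)
qed

text \<open>Induction by splitting: \<open>K\<close> is connected outside \<open>X\<close>, so
  \<open>cactus_component_meets_once\<close> makes the interface a single vertex, as
  \<open>amalgam\<close> demands.\<close>

lemma (in loopfree_digraph) cactus_in_cycle_closure:
  assumes "F \<subseteq> arcs G" "balanced F" "conn F" "F \<noteq> {}" "cactus F"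
  shows "arc_subgraph G F \<in> cycle_closure"
  using balanced_finite[OF assms(2)] assms
proof (induction F rule: finite_psubset_induct)
  case (psubset F)
  obtain X where X: "ecycle X" "X \<subseteq> F" using ex_ecycle psubset.prems by blast
  show ?case
  proof (cases "X = F")
    case True
    let ?H = "arc_subgraph G F"
    have H: "fin_digraph ?H" "loopfree_digraph ?H"
      using psubset.hyps psubset.prems(1) no_loops
      by (unfold_locales; auto simp: arc_subgraph_def)+
    interpret H: fin_digraph ?H by (rule H(1))
    have "F \<in> H.ecycles (arcs ?H)"
      using X True by (simp add: arc_subgraph_def incidence.ecycles_def)
    then obtain c where c: "c \<in> cycles ?H" "circuit_arcs c = F"
      unfolding H.circuit_arcs_cycles[symmetric] by blast
    moreover have "?H = arc_subgraph ?H F" by (simp add: arc_subgraph_def)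
    ultimately have "cycle_digraph ?H" using H unfolding cycle_digraph_def by metis
    then show ?thesis by (rule cycle_closure.cycle)
  next
    case False
    then have XF: "X \<subset> F" using X(2) by blast
    obtain K where K: "K \<noteq> {}" "K \<subseteq> F - X" "balanced K" "conn K" "balanced (F - K)" "conn (F - K)"
      and int: "ends K \<inter> ends (F - K) = ends K \<inter> ends X" and ne: "ends K \<inter> ends X \<noteq> {}"
      by (rule split_off_component[OF psubset.prems(2,3) X(1) XF])
    have L: "F - K \<noteq> {}" "F - K \<subset> F" "K \<subset> F" using K(1,2) X ecycle_nonempty by blast+
    have in_closure: "arc_subgraph G K \<in> cycle_closure" "arc_subgraph G (F - K) \<in> cycle_closure"
      using psubset.IH[OF L(3) _ K(3,4,1)] psubset.IH[OF L(2) _ K(5,6) L(1)]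
        cactus_subset[OF psubset.prems(5)] psubset.prems(1) L by auto
    obtain x where x: "x \<in> ends K \<inter> ends X" using ne by blast
    have "y = x" if "y \<in> ends K \<inter> ends X" for y
    proof -
      have "(y, x) \<in> (adj K)\<^sup>*" using K(4) x that by (simp add: conn_def)
      then have "(y, x) \<in> (adj (F - X))\<^sup>*" using reach_mono K(2) by blast
      then show ?thesis
        using cactus_component_meets_once[OF psubset.prems(5) X] x that by blast
    qed
    then have "ends K \<inter> ends (F - K) = {x}" using int x by blast
    moreover have "verts (arc_subgraph G Y) = ends Y" for Y by (simp add: arc_subgraph_def ends_def)
    ultimately have "card (verts (arc_subgraph G K) \<inter> verts (arc_subgraph G (F - K))) = 1" by simp
    moreover have "compatible (arc_subgraph G K) (arc_subgraph G (F - K))"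
      by (simp add: compatible_def arc_subgraph_def)
    ultimately have "Digraph_Component.union (arc_subgraph G K) (arc_subgraph G (F - K)) \<in> cycle_closure"
      using in_closure cycle_closure.amalgam by blast
    moreover have "Digraph_Component.union (arc_subgraph G K) (arc_subgraph G (F - K)) = arc_subgraph G F"
    proof -
      have "K \<union> (F - K) = F" using L by blast
      then have "tail G ` K \<union> head G ` K \<union> (tail G ` (F - K) \<union> head G ` (F - K)) = tail G ` F \<union> head G ` F"
        using ends_Un[of K "F - K"] by (simp add: ends_def)
      then show ?thesis
        using \<open>K \<union> (F - K) = F\<close> by (simp add: Digraph_Component.union_def arc_subgraph_def)
    qed
    ultimately show ?thesis by simp
  qed
qed

section \<open>Arborescences\<close>

context incidence begin

text \<open>The incidence maps of \<^const>\<open>underlying\<close>.\<close>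

definition ut :: "'b \<times> bool \<Rightarrow> 'a" where "ut = (\<lambda>(e, b). if b then t e else h e)"
definition uh :: "'b \<times> bool \<Rightarrow> 'a" where "uh = (\<lambda>(e, b). if b then h e else t e)"

lemma ut_uh_simps [simp]:
  "ut (e, True) = t e" "ut (e, False) = h e" "uh (e, True) = h e" "uh (e, False) = t e"
  by (simp_all add: ut_def uh_def)

interpretation U: incidence ut uh .

text \<open>\<open>undirected_tree\<close> and \<open>directed_away\<close> in one, with vertex set
  and arc set kept apart so that partial trees can be grown one leaf at a time.\<close>

definition rooted_tree :: "'a \<Rightarrow> 'a set \<Rightarrow> 'b set \<Rightarrow> bool" where
  "rooted_tree u W F \<longleftrightarrow> u \<in> W \<and> ends F \<subseteq> W \<and>
    (\<forall>x\<in>W. \<forall>y\<in>W. \<exists>!p. incidence.spath ut uh x p y \<and> set p \<subseteq> F \<times> UNIV) \<and>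
    (\<forall>e\<in>F. \<exists>p. incidence.spath ut uh u (p @ [(e, True)]) (h e) \<and> set p \<subseteq> F \<times> UNIV)"

lemma spath_forward: "U.spath u (map (\<lambda>e. (e, True)) p) v \<longleftrightarrow> spath u p v"
proof -
  have "U.walk u (map (\<lambda>e. (e, True)) p) v \<longleftrightarrow> walk u p v"
    by (induction p arbitrary: u) auto
  then show ?thesis by (simp add: spath_def U.spath_def comp_def)
qed

text \<open>If the last step ran backwards along \<open>e\<close>, the path before it would end in
  \<open>h e\<close>; by uniqueness it is the path whose last step is \<open>e\<close> forwards,
  which already visits \<open>t e\<close>, so \<open>t e\<close> would occur twice.\<close>

lemma rooted_tree_spath_forward:
  assumes T: "rooted_tree u W F"
  shows "U.spath u q v \<Longrightarrow> set q \<subseteq> F \<times> UNIV \<Longrightarrow> \<exists>p. q = map (\<lambda>e. (e, True)) p"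
proof (induction q arbitrary: v rule: rev_induct)
  case (snoc a q)
  obtain e b where a: "a = (e, b)" by fastforce
  have e: "e \<in> F" using snoc.prems(2) a by simp
  have q: "U.spath u q (ut a)" "v = uh a" "v \<notin> insert u (uh ` set q)" "set q \<subseteq> F \<times> UNIV"
    using snoc.prems by (auto simp: U.spath_append_arc)
  obtain p where p: "q = map (\<lambda>e. (e, True)) p" using snoc.IH q by blast
  show ?case
  proof (cases b)
    case True
    then have "q @ [a] = map (\<lambda>e. (e, True)) (p @ [e])" using p a by simp
    then show ?thesis by blast
  next
    case False
    then have end_q: "U.spath u q (h e)" "v = t e" using q a by simp_all
    obtain r where r: "U.spath u (r @ [(e, True)]) (h e)" "set r \<subseteq> F \<times> UNIV"
      using T e by (auto simp: rooted_tree_def)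
    have "u \<in> W" "h e \<in> W" using T e by (auto simp: rooted_tree_def ends_def)
    then have "\<exists>!p. U.spath u p (h e) \<and> set p \<subseteq> F \<times> UNIV"
      using T by (simp add: rooted_tree_def)
    moreover have "set (r @ [(e, True)]) \<subseteq> F \<times> UNIV" using r(2) e by simp
    ultimately have "q = r @ [(e, True)]" using end_q(1) q(4) r(1) by blast
    moreover have "t e \<in> insert u (uh ` set r)"
      using r(1) U.spath_last[of u r "t e"] by (simp add: U.spath_append_arc)
    ultimately show ?thesis using q(3) end_q(2) by auto
  qed
qed simp

lemma rooted_tree_spath:
  assumes T: "rooted_tree u W F" and v: "v \<in> W"
  shows "\<exists>p. spath u p v \<and> set p \<subseteq> F"
proof -
  have "u \<in> W" using T by (simp add: rooted_tree_def)
  then obtain q where q: "U.spath u q v" "set q \<subseteq> F \<times> UNIV"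
    using T v unfolding rooted_tree_def by blast
  then obtain p where p: "q = map (\<lambda>e. (e, True)) p" using rooted_tree_spath_forward[OF T] by blast
  have "spath u p v" "set p \<subseteq> F" using q p spath_forward by auto
  then show ?thesis by blast
qed

lemma rooted_tree_arc:
  assumes T: "rooted_tree u W F" and e: "e \<in> F"
  shows "\<exists>p. spath u (p @ [e]) (h e) \<and> set p \<subseteq> F"
proof -
  obtain r where r: "U.spath u (r @ [(e, True)]) (h e)" "set r \<subseteq> F \<times> UNIV"
    using T e by (auto simp: rooted_tree_def)
  moreover have "U.spath u r (t e)" using r by (simp add: U.spath_append_arc)
  ultimately obtain p where p: "r = map (\<lambda>e. (e, True)) p"
    using rooted_tree_spath_forward[OF T] by blast
  then have "U.spath u (map (\<lambda>e. (e, True)) (p @ [e])) (h e)" using r(1) by simp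
  then have "spath u (p @ [e]) (h e)" by (simp only: spath_forward)
  then show ?thesis using r(2) p by auto
qed

lemma rooted_tree_spath_unique:
  assumes T: "rooted_tree u W F" and p: "spath u p v" "set p \<subseteq> F" and q: "spath u q v" "set q \<subseteq> F"
    and v: "v \<in> W"
  shows "p = q"
proof -
  let ?f = "map (\<lambda>e. (e, True))"
  have "U.spath u (?f p) v \<and> set (?f p) \<subseteq> F \<times> UNIV" "U.spath u (?f q) v \<and> set (?f q) \<subseteq> F \<times> UNIV"
    using p q by (auto simp: spath_forward)
  moreover have "\<exists>!p. U.spath u p v \<and> set p \<subseteq> F \<times> UNIV"
    using T v by (simp add: rooted_tree_def)
  ultimately have "?f p = ?f q" by blast
  then show ?thesis by (simp add: inj_map_eq_map inj_def)
qed

text \<open>The path of the first tree that ends with \<open>e\<close> and the path of the second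
  tree to \<open>h e\<close> have the same ends, hence the same arcs in a cactus.\<close>

lemma cactus_rooted_tree_subset:
  assumes E: "balanced E" "cactus E"
    and T: "rooted_tree u W F" "F \<subseteq> E" and T': "rooted_tree u W F'" "F' \<subseteq> E"
  shows "F \<subseteq> F'"
proof
  fix e assume e: "e \<in> F"
  obtain p where p: "spath u (p @ [e]) (h e)" "set p \<subseteq> F" using rooted_tree_arc[OF T(1) e] by blast
  have "h e \<in> W" using T(1) e by (auto simp: rooted_tree_def ends_def)
  then obtain q where q: "spath u q (h e)" "set q \<subseteq> F'" using rooted_tree_spath[OF T'(1)] by blast
  have "set (p @ [e]) \<subseteq> set q"
    using cactus_spath_subset[OF E p(1) _ q(1)] p(2) q(2) T(2) T'(2) e by auto
  then show "e \<in> F'" using q(2) by auto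
qed

lemma rooted_tree_single: "rooted_tree u {u} {}"
proof -
  have "\<exists>!p. U.spath u p u \<and> set p \<subseteq> {} \<times> UNIV"
    by (rule ex1I[of _ "[]"]) (simp_all add: U.spath_Nil)
  then show ?thesis by (simp add: rooted_tree_def ends_def)
qed

text \<open>The vertex \<open>h e\<close> becomes a leaf: the two copies of \<open>e\<close> are the
  only doubled arcs at it, so a simple path can use \<open>e\<close> only in its first or last
  step.\<close>

lemma rooted_tree_insert:
  assumes T: "rooted_tree u W F" and e: "t e \<in> W" "h e \<notin> W"
  shows "rooted_tree u (insert (h e) W) (insert e F)"
proof -
  let ?W = "insert (h e) W" and ?F = "insert e F"
  have "ends F \<subseteq> W" using T by (simp add: rooted_tree_def)
  then have FW: "ut a \<in> W" "uh a \<in> W" if "a \<in> F \<times> UNIV" for a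
    using that by (auto simp: ends_def ut_def uh_def split: prod.splits)
  have cases_F: "a \<in> F \<times> UNIV \<or> a = (e, True) \<or> a = (e, False)" if "a \<in> ?F \<times> UNIV" for a
    using that by auto
  \<comment> \<open>A path with both ends in \<open>W\<close> that enters \<open>h e\<close> could
    only return along \<open>e\<close>, back to a vertex already visited.\<close>
  have old: "set p \<subseteq> F \<times> UNIV"
    if "U.spath x p y" "set p \<subseteq> ?F \<times> UNIV" "x \<in> W" "y \<in> W" for x p y
    using that
  proof (induction p arbitrary: x)
    case (Cons a p)
    have a: "a \<in> ?F \<times> UNIV" and p: "set p \<subseteq> ?F \<times> UNIV" using Cons.prems(2) by auto
    have sp: "ut a = x" "U.spath (uh a) p y" "x \<notin> uh ` set p"
      using Cons.prems(1) by (auto simp: U.spath_Cons)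
    from cases_F[OF a] consider "a \<in> F \<times> UNIV" | "a = (e, True)" | "a = (e, False)" by blast
    then show ?case
    proof cases
      case 1
      then have "set p \<subseteq> F \<times> UNIV" using Cons.IH[OF sp(2) p] FW Cons.prems(4) by blast
      then show ?thesis using 1 by simp
    next
      case 2
      then have "p \<noteq> []" using sp(2) e Cons.prems(4) by (auto simp: U.spath_Nil)
      then obtain b q where b: "p = b # q" by (cases p) auto
      have tb: "ut b = h e" using sp(2) b 2 by (simp add: U.spath_Cons)
      have "b \<in> ?F \<times> UNIV" using p b by simp
      then have "b = (e, False)" using cases_F[of b] FW[of b] tb e by auto
      then show ?thesis using sp b 2 by simp
    next
      case 3
      then show ?thesis using sp Cons.prems(3) e by simp
    qed
  qed simp
  have W_path: "insert x (uh ` set p) \<subseteq> W" if "x \<in> W" "set p \<subseteq> F \<times> UNIV" for x p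
    using that FW by blast
  have unique: "\<exists>!p. U.spath x p y \<and> set p \<subseteq> F \<times> UNIV" if "x \<in> W" "y \<in> W" for x y
    using T that by (simp add: rooted_tree_def)
  have "\<exists>!p. U.spath x p y \<and> set p \<subseteq> ?F \<times> UNIV" if x: "x \<in> ?W" and y: "y \<in> ?W" for x y
  proof -
    consider "x \<in> W" "y \<in> W" | "x \<in> W" "y = h e" | "x = h e" "y \<in> W" | "x = h e" "y = h e"
      using x y by blast
    then show ?thesis
    proof cases
      case 1
      obtain p where p: "U.spath x p y \<and> set p \<subseteq> F \<times> UNIV"
        and only: "\<And>q. U.spath x q y \<and> set q \<subseteq> F \<times> UNIV \<Longrightarrow> q = p"
        using unique[OF 1] by blast
      show ?thesis
      proof (rule ex1I[of _ p])
        show "U.spath x p y \<and> set p \<subseteq> ?F \<times> UNIV" using p by blast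
        show "q = p" if q: "U.spath x q y \<and> set q \<subseteq> ?F \<times> UNIV" for q
          using only old[of x q y] q 1 by blast
      qed
    next
      case 2
      obtain p where p: "U.spath x p (t e) \<and> set p \<subseteq> F \<times> UNIV"
        and only: "\<And>q. U.spath x q (t e) \<and> set q \<subseteq> F \<times> UNIV \<Longrightarrow> q = p"
        using unique[OF 2(1) e(1)] by blast
      show ?thesis
      proof (rule ex1I[of _ "p @ [(e, True)]"])
        have "h e \<notin> insert x (uh ` set p)" using W_path[of x p] p 2(1) e(2) by blast
        then show "U.spath x (p @ [(e, True)]) y \<and> set (p @ [(e, True)]) \<subseteq> ?F \<times> UNIV"
          using p 2(2) by (auto simp: U.spath_append_arc)
        fix q assume q: "U.spath x q y \<and> set q \<subseteq> ?F \<times> UNIV"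
        have "q \<noteq> []" using q 2 e by (auto simp: U.spath_Nil)
        then obtain q' a where a: "q = q' @ [a]" by (metis append_butlast_last_id)
        have sp: "U.spath x q' (ut a)" "uh a = h e" using q a 2(2) by (simp_all add: U.spath_append_arc)
        have "a \<in> ?F \<times> UNIV" using q a by simp
        then have "a = (e, True)" using cases_F[of a] FW[of a] sp(2) e by auto
        moreover from this have "q' = p"
          using only old[of x q' "t e"] sp(1) q a 2(1) e(1) by auto
        ultimately show "q = p @ [(e, True)]" using a by simp
      qed
    next
      case 3
      obtain p where p: "U.spath (t e) p y \<and> set p \<subseteq> F \<times> UNIV"
        and only: "\<And>q. U.spath (t e) q y \<and> set q \<subseteq> F \<times> UNIV \<Longrightarrow> q = p"
        using unique[OF e(1) 3(2)] by blast
      show ?thesis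
      proof (rule ex1I[of _ "(e, False) # p"])
        have "h e \<notin> insert (t e) (uh ` set p)" using W_path[of "t e" p] p e by blast
        then show "U.spath x ((e, False) # p) y \<and> set ((e, False) # p) \<subseteq> ?F \<times> UNIV"
          using p 3(1) by (auto simp: U.spath_Cons)
        fix q assume q: "U.spath x q y \<and> set q \<subseteq> ?F \<times> UNIV"
        have "q \<noteq> []" using q 3 e by (auto simp: U.spath_Nil)
        then obtain a q' where a: "q = a # q'" by (cases q) auto
        have sp: "U.spath (uh a) q' y" "ut a = h e" using q a 3(1) by (simp_all add: U.spath_Cons)
        have "a \<in> ?F \<times> UNIV" using q a by simp
        then have "a = (e, False)" using cases_F[of a] FW[of a] sp(2) e by auto
        moreover from this have "q' = p"
          using only old[of "t e" q' y] sp(1) q a 3(2) e(1) by auto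
        ultimately show "q = (e, False) # p" using a by simp
      qed
    next
      case 4
      have "q = []" if "U.spath x q y" for q
      proof (cases q)
        case (Cons a r)
        then have "y \<in> insert (uh a) (uh ` set r)" "x \<notin> insert (uh a) (uh ` set r)"
          using that U.spath_last[of "uh a" r y] by (auto simp: U.spath_Cons)
        then show ?thesis using 4 by simp
      qed simp
      moreover have "U.spath x [] y" using 4 by (simp add: U.spath_Nil)
      ultimately show ?thesis by (intro ex1I[of _ "[]"]) auto
    qed
  qed
  moreover have "\<exists>p. U.spath u (p @ [(f, True)]) (h f) \<and> set p \<subseteq> ?F \<times> UNIV" if f: "f \<in> ?F" for f
  proof (cases "f \<in> F")
    case True
    then obtain p where "U.spath u (p @ [(f, True)]) (h f)" "set p \<subseteq> F \<times> UNIV"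
      using T by (auto simp: rooted_tree_def)
    then show ?thesis by blast
  next
    case False
    then have fe: "f = e" using f by simp
    have u: "u \<in> W" using T by (simp add: rooted_tree_def)
    then obtain p where p: "U.spath u p (t e)" "set p \<subseteq> F \<times> UNIV" using unique e(1) by blast
    have "h e \<notin> insert u (uh ` set p)" using W_path[OF u p(2)] e(2) by blast
    then have "U.spath u (p @ [(e, True)]) (h e)" using p by (simp add: U.spath_append_arc)
    then show ?thesis using fe p(2) by blast
  qed
  moreover have "u \<in> ?W" "ends ?F \<subseteq> ?W"
    using T e(1) by (auto simp: rooted_tree_def ends_def)
  ultimately show ?thesis by (simp add: rooted_tree_def)
qed

text \<open>Each arc of a simple path ends in a new vertex, so the path is itself a tree grown leaf
  by leaf; \<open>F\<close> is just \<open>set p\<close>.\<close>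

lemma rooted_tree_of_spath:
  "spath u p v \<Longrightarrow> \<exists>F. rooted_tree u (insert u (h ` set p)) F \<and> set p \<subseteq> F \<and> F \<subseteq> set p"
proof (induction p arbitrary: v rule: rev_induct)
  case Nil
  then show ?case using rooted_tree_single by auto
next
  case (snoc e p)
  then have p: "spath u p (t e)" "h e \<notin> insert u (h ` set p)" by (auto simp: spath_append_arc)
  then obtain F where F: "rooted_tree u (insert u (h ` set p)) F" "set p \<subseteq> F" "F \<subseteq> set p"
    using snoc.IH by blast
  have "rooted_tree u (insert (h e) (insert u (h ` set p))) (insert e F)"
    using rooted_tree_insert[OF F(1)] spath_last[OF p(1)] p(2) by blast
  moreover have "insert (h e) (insert u (h ` set p)) = insert u (h ` set (p @ [e]))" by auto
  ultimately show ?case using F(2,3) by (intro exI[of _ "insert e F"]) auto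
qed

text \<open>As long as \<open>V\<close> is not all of \<open>W\<close>, reachability provides an arc
  of \<open>E\<close> leaving \<open>V\<close>, whose head becomes a new leaf.\<close>

lemma rooted_tree_extend:
  assumes "finite W" and reach: "\<And>v. v \<in> W \<Longrightarrow> (u, v) \<in> (adj E)\<^sup>*" and EW: "ends E \<subseteq> W"
  shows "rooted_tree u V F \<Longrightarrow> V \<subseteq> W \<Longrightarrow> F \<subseteq> E \<Longrightarrow> \<exists>F'. F \<subseteq> F' \<and> F' \<subseteq> E \<and> rooted_tree u W F'"
proof (induction "card (W - V)" arbitrary: V F rule: less_induct)
  case less
  show ?case
  proof (cases "V = W")
    case False
    have "\<exists>e\<in>E. t e \<in> V \<and> h e \<notin> V"
    proof (rule ccontr)
      assume no: "\<not> ?thesis"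
      have "v \<in> V" if "(u, v) \<in> (adj E)\<^sup>*" for v
        using that
      proof (induction rule: rtrancl_induct)
        case base
        show ?case using less.prems(1) by (simp add: rooted_tree_def)
      next
        case (step y z)
        then obtain e where "e \<in> E" "y = t e" "z = h e" unfolding adj_def by blast
        then show ?case using no step.IH by blast
      qed
      then show False using reach less.prems(2) False by blast
    qed
    then obtain e where e: "e \<in> E" "t e \<in> V" "h e \<notin> V" by blast
    have he: "h e \<in> W" using EW e(1) by (auto simp: ends_def)
    have "W - insert (h e) V \<subset> W - V" using he e(3) by blast
    then have "card (W - insert (h e) V) < card (W - V)" using assms(1) by (intro psubset_card_mono) auto
    moreover have "rooted_tree u (insert (h e) V) (insert e F)"
      using rooted_tree_insert[OF less.prems(1) e(2,3)] .
    ultimately obtain F' where "insert e F \<subseteq> F'" "F' \<subseteq> E" "rooted_tree u W F'"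
      using less.hyps[of "insert (h e) V" "insert e F"] he e(1) less.prems(2,3) by auto
    then show ?thesis by blast
  qed (use less.prems in blast)
qed

end

text \<open>A spanning subdigraph shares everything but its arc set with \<open>G\<close>, so
  uniqueness of an arborescence becomes uniqueness of its arc set.\<close>

lemma (in wf_digraph) arborescence_iff:
  "arborescence G u T \<longleftrightarrow> verts T = verts G \<and> arcs T \<subseteq> arcs G \<and> tail T = tail G \<and> head T = head G \<and>
    rooted_tree u (verts G) (arcs T)"
proof (cases "verts T = verts G \<and> arcs T \<subseteq> arcs G \<and> tail T = tail G \<and> head T = head G")
  case True
  have apath: "pre_digraph.apath (underlying T) x p y \<longleftrightarrow>
    x \<in> verts T \<and> set p \<subseteq> arcs T \<times> UNIV \<and> incidence.spath ut uh x p y" for x p y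
    using True
    by (simp add: pre_digraph.apath_eq_spath underlying_def ut_def uh_def cong del: if_weak_cong)
  have wf: "wf_digraph T \<longleftrightarrow> ends (arcs T) \<subseteq> verts T"
    using True by (auto simp: wf_digraph_def ends_def)
  have span: "spanning T G \<longleftrightarrow> wf_digraph T"
    using True by (auto simp: spanning_def subgraph_def compatible_def wf_digraph)
  have tree: "undirected_tree T \<longleftrightarrow> verts T \<noteq> {} \<and> (\<forall>x\<in>verts T. \<forall>y\<in>verts T.
      \<exists>!p. incidence.spath ut uh x p y \<and> set p \<subseteq> arcs T \<times> UNIV)"
    by (simp add: undirected_tree_def apath conj_commute)
  have away: "directed_away T u \<longleftrightarrow> (\<forall>e\<in>arcs T. \<exists>p.
      incidence.spath ut uh u (p @ [(e, True)]) (head G e) \<and> set p \<subseteq> arcs T \<times> UNIV)"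
    if "u \<in> verts T"
    using that True by (simp add: directed_away_def apath conj_commute)
  show ?thesis
    unfolding arborescence_def span wf rooted_tree_def
    using tree away True by auto
next
  case False
  then show ?thesis by (auto simp: arborescence_def spanning_def subgraph_def compatible_def)
qed

context fin_digraph begin

lemma ex_arborescence_containing:
  assumes conn: "conn (arcs G)" and V: "verts G = ends (arcs G)"
    and p: "spath u p v" "set p \<subseteq> arcs G" and u: "u \<in> verts G"
  shows "\<exists>T. arborescence G u T \<and> set p \<subseteq> arcs T"
proof -
  obtain F where F: "rooted_tree u (insert u (head G ` set p)) F" "set p \<subseteq> F" "F \<subseteq> set p"
    using rooted_tree_of_spath[OF p(1)] by blast
  have "insert u (head G ` set p) \<subseteq> verts G" "F \<subseteq> arcs G" using u p(2) F(3) by auto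
  moreover have "(u, v) \<in> (adj (arcs G))\<^sup>*" if "v \<in> verts G" for v
    using conn V u that by (simp add: conn_def)
  ultimately obtain F' where F': "F \<subseteq> F'" "F' \<subseteq> arcs G" "rooted_tree u (verts G) F'"
    using rooted_tree_extend[of "verts G" u "arcs G", OF finite_verts _ _ F(1)] V by blast
  let ?T = "\<lparr>verts = verts G, arcs = F', tail = tail G, head = head G\<rparr>"
  have "arborescence G u ?T" using F' by (simp add: arborescence_iff)
  then show ?thesis using F(2) F'(1) by (intro exI[of _ ?T]) auto
qed

lemma cactus_iff_unique_arborescence:
  assumes bal: "balanced (arcs G)" and conn: "conn (arcs G)" and V: "verts G = ends (arcs G)"
  shows "cactus (arcs G) \<longleftrightarrow> (\<forall>u\<in>verts G. \<exists>!T. arborescence G u T)"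
proof
  assume cac: "cactus (arcs G)"
  show "\<forall>u\<in>verts G. \<exists>!T. arborescence G u T"
  proof
    fix u assume u: "u \<in> verts G"
    \<comment> \<open>The empty path turns the extension lemma into mere existence of an
      arborescence.\<close>
    have "spath u [] u" by (simp add: spath_Nil)
    then obtain T where T: "arborescence G u T"
      using ex_arborescence_containing[OF conn V, of u "[]" u] u by auto
    have sub: "arcs S \<subseteq> arcs S'" if "arborescence G u S" "arborescence G u S'" for S S'
      using cactus_rooted_tree_subset[OF bal cac, of u "verts G" "arcs S" "arcs S'"] that
      by (simp add: arborescence_iff)
    have "T' = T" if T': "arborescence G u T'" for T'
    proof -
      have "arcs T' = arcs T" using sub T T' by blast
      then show ?thesis using T T' by (simp add: arborescence_iff)
    qed
    then show "\<exists>!T. arborescence G u T" using T by blast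
  qed
next
  assume unique: "\<forall>u\<in>verts G. \<exists>!T. arborescence G u T"
  show "cactus (arcs G)"
    unfolding cactus_def
  proof (intro ballI impI)
    fix C C' assume C: "C \<in> ecycles (arcs G)" "C' \<in> ecycles (arcs G)" "C \<inter> C' \<noteq> {}"
    then obtain e where e: "e \<in> C" "e \<in> C'" by blast
    have eG: "e \<in> arcs G" using C(1) e(1) by (auto simp: ecycles_def)
    obtain p where p: "spath (head G e) p (tail G e)" "set p = C - {e}"
      using ecycle_spath[OF _ e(1)] C(1) by (auto simp: ecycles_def)
    obtain q where q: "spath (head G e) q (tail G e)" "set q = C' - {e}"
      using ecycle_spath[OF _ e(2)] C(2) by (auto simp: ecycles_def)
    have pq: "set p \<subseteq> arcs G" "set q \<subseteq> arcs G" using p(2) q(2) C(1,2) by (auto simp: ecycles_def)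
    have he: "head G e \<in> verts G" using eG by simp
    obtain T where T: "arborescence G (head G e) T" "set p \<subseteq> arcs T"
      using ex_arborescence_containing[OF conn V p(1) pq(1) he] by blast
    obtain T' where T': "arborescence G (head G e) T'" "set q \<subseteq> arcs T'"
      using ex_arborescence_containing[OF conn V q(1) pq(2) he] by blast
    \<comment> \<open>The one arborescence rooted at \<open>head G e\<close> contains both paths to
      \<open>tail G e\<close>, and paths from its root are unique.\<close>
    have "T' = T" using unique he T(1) T'(1) by blast
    then have "p = q"
      using rooted_tree_spath_unique[OF _ p(1) T(2) q(1), of "verts G"] T(1) T'(2) eG
      by (simp add: arborescence_iff)
    then have "C - {e} = C' - {e}" using p(2) q(2) by simp
    then show "C = C'" using e by blast
  qed
qed


end

section \<open>Partitions into connected Eulerian parts\<close>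

context incidence begin

text \<open>
  The join in the partition lattice: its parts are unions of overlapping balanced connected sets
  and therefore again balanced and connected.
\<close>
lemma ex_join:
  assumes fin: "finite E" and ne: "\<S> \<noteq> {}"
    and \<S>: "\<And>P. P \<in> \<S> \<Longrightarrow> partition_on E P \<and> (\<forall>F\<in>P. balanced F \<and> conn F)"
  shows "\<exists>J. partition_on E J \<and> (\<forall>F\<in>J. balanced F \<and> conn F) \<and> (\<forall>P\<in>\<S>. refines E P J) \<and>
    (\<forall>Z. partition_on E Z \<longrightarrow> (\<forall>P\<in>\<S>. refines E P Z) \<longrightarrow> refines E J Z)"
proof -
  \<comment> \<open>Arcs are related when some member of the family puts them into one part; the
    classes of the transitive closure are the parts of the join.\<close>
  define r where "r = {(a, b). \<exists>P\<in>\<S>. \<exists>Y\<in>P. a \<in> Y \<and> b \<in> Y}"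
  define R where "R = r\<^sup>* \<inter> E \<times> E"
  define J where "J = E // R"
  have YE: "Y \<subseteq> E" if "P \<in> \<S>" "Y \<in> P" for P Y
    using \<S>[OF that(1)] that(2) by (auto simp: partition_on_def)
  have symr: "sym (r\<^sup>*)" by (rule sym_rtrancl) (auto simp: r_def sym_def)
  have "equiv E R"
  proof (rule equivI)
    show "R \<subseteq> E \<times> E" by (simp add: R_def)
    show "refl_on E R" by (auto simp: R_def refl_on_def)
    show "sym R" using symr by (auto simp: R_def sym_def)
    show "trans R" by (auto simp: R_def trans_def)
  qed
  then have part: "partition_on E J" unfolding J_def by (rule partition_on_quotient)
  have J_elem: "\<exists>a\<in>E. F = {b \<in> E. (a, b) \<in> r\<^sup>*}" if "F \<in> J" for F
    using that by (auto simp: J_def R_def quotient_def)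
  have J_closed: "Y \<subseteq> F" if F: "F \<in> J" and P: "P \<in> \<S>" and Y: "Y \<in> P" and y: "y \<in> Y" "y \<in> F" for F P Y y
  proof
    fix z assume z: "z \<in> Y"
    obtain a where a: "F = {b \<in> E. (a, b) \<in> r\<^sup>*}" using J_elem[OF F] by blast
    have "(y, z) \<in> r" using P Y y z by (auto simp: r_def)
    moreover have "(a, y) \<in> r\<^sup>*" using y(2) a by simp
    ultimately have "(a, z) \<in> r\<^sup>*" by (rule rtrancl_into_rtrancl[rotated])
    then show "z \<in> F" using a YE[OF P Y] z by blast
  qed
  have up: "refines E P J" if P: "P \<in> \<S>" for P
    unfolding refines_def
  proof (intro conjI ballI)
    fix Y assume Y: "Y \<in> P"
    then obtain y where y: "y \<in> Y" using \<S>[OF P] by (metis all_not_in_conv partition_onD3)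
    then obtain F where "F \<in> J" "y \<in> F" using part YE[OF P Y] by (auto simp: partition_on_def)
    then show "\<exists>F\<in>J. Y \<subseteq> F" using J_closed[OF _ P Y y] by blast
  qed (use \<S>[OF P] part in auto)
  have good: "balanced F \<and> conn F" if F: "F \<in> J" for F
  proof -
    \<comment> \<open>Any single member \<open>P\<close> shows balance: \<open>F\<close> is a
      disjoint union of parts of \<open>P\<close>.\<close>
    obtain P where P: "P \<in> \<S>" using ne by blast
    have pP: "partition_on E P" using \<S>[OF P] by blast
    obtain a where a: "a \<in> E" "F = {b \<in> E. (a, b) \<in> r\<^sup>*}" using J_elem[OF F] by blast
    have "F = \<Union>{Y \<in> P. Y \<subseteq> F}"
    proof
      show "F \<subseteq> \<Union>{Y \<in> P. Y \<subseteq> F}"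
      proof
        fix y assume y: "y \<in> F"
        then obtain Y where "Y \<in> P" "y \<in> Y" using pP a by (auto simp: partition_on_def)
        then show "y \<in> \<Union>{Y \<in> P. Y \<subseteq> F}" using J_closed[OF F P _ _ y] by blast
      qed
    qed blast
    moreover have "balanced (\<Union>{Y \<in> P. Y \<subseteq> F})"
    proof (rule balanced_Union)
      have "finite P" using fin partition_onD1[OF pP] finite_UnionD[of P] by simp
      then show "finite {Y \<in> P. Y \<subseteq> F}" by simp
      show "disjoint {Y \<in> P. Y \<subseteq> F}"
        using partition_onD2[OF pP] by (rule pairwise_subset) blast
      show "balanced Y" if "Y \<in> {Y \<in> P. Y \<subseteq> F}" for Y
        using \<S>[OF P] that by blast
    qed
    ultimately have bal: "balanced F" by simp
    \<comment> \<open>A chain of related arcs from \<open>a\<close> to \<open>b\<close> runs through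
      connected parts that lie inside \<open>F\<close>, which link the tails.\<close>
    have "conn F"
    proof (rule balanced_connI[OF bal])
      fix b assume "b \<in> F"
      then have "(a, b) \<in> r\<^sup>*" using a by blast
      then have "b \<in> E \<and> (t a, t b) \<in> (adj F)\<^sup>*"
      proof (induction rule: rtrancl_induct)
        case base
        show ?case using a by simp
      next
        case (step y z)
        then obtain P Y where PY: "P \<in> \<S>" "Y \<in> P" "y \<in> Y" "z \<in> Y" unfolding r_def by blast
        have "y \<in> F" using step a by simp
        then have YF: "Y \<subseteq> F" using J_closed[OF F PY(1-3)] by blast
        have "conn Y" using \<S>[OF PY(1)] PY(2) by blast
        moreover have "t y \<in> ends Y" "t z \<in> ends Y" using PY(3,4) by (auto simp: ends_def)
        ultimately have "(t y, t z) \<in> (adj Y)\<^sup>*" unfolding conn_def by blast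
        then have "(t y, t z) \<in> (adj F)\<^sup>*" using reach_mono[OF _ YF] by blast
        then show ?case using step.IH YF PY(4) a(2) by (meson YE PY(1,2) rtrancl_trans subsetD)
      qed
      then show "(t a, t b) \<in> (adj F)\<^sup>*" by blast
    qed
    then show ?thesis using bal by blast
  qed
  have least: "refines E J Z" if Z: "partition_on E Z" "\<forall>P\<in>\<S>. refines E P Z" for Z
    unfolding refines_def
  proof (intro conjI ballI part Z(1))
    fix F assume F: "F \<in> J"
    obtain a where a: "a \<in> E" "F = {b \<in> E. (a, b) \<in> r\<^sup>*}" using J_elem[OF F] by blast
    obtain W where W: "W \<in> Z" "a \<in> W" using Z(1) a(1) by (auto simp: partition_on_def)
    have "b \<in> W" if "(a, b) \<in> r\<^sup>*" for b
      using that
    proof (induction rule: rtrancl_induct)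
      case (step y z)
      then obtain P Y where PY: "P \<in> \<S>" "Y \<in> P" "y \<in> Y" "z \<in> Y" unfolding r_def by blast
      then obtain W' where W': "W' \<in> Z" "Y \<subseteq> W'" using Z(2) by (meson refines_def)
      then have "W' = W"
        using partition_onD2[OF Z(1)] W(1) step.IH PY(3) by (meson disjnt_iff pairwiseD subsetD)
      then show ?case using W'(2) PY(4) by blast
    qed (rule W(2))
    then have "F \<subseteq> W" using a by blast
    then show "\<exists>W\<in>Z. F \<subseteq> W" using W(1) by blast
  qed
  show ?thesis using part good up least by blast
qed

lemma cactus_partition:
  assumes "balanced E" "cactus E"
  shows "partition_on E (ecycles E)"
proof (rule partition_onI)
  show "\<Union> (ecycles E) = E" using arc_in_ecycle[OF assms(1)] by (auto simp: ecycles_def)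
  show "disjnt p q" if "p \<in> ecycles E" "q \<in> ecycles E" "p \<noteq> q" for p q
    using that assms(2) by (auto simp: cactus_def disjnt_def)
  show "{} \<notin> ecycles E" using ecycle_nonempty by (auto simp: ecycles_def)
qed

text \<open>The part of \<open>P\<close> that contains an arc of a cycle \<open>C\<close> has a
  cycle through this arc, which in a cactus must be \<open>C\<close>.\<close>

lemma cactus_partition_refines:
  assumes E: "balanced E" "cactus E" and P: "partition_on E P" "\<forall>F\<in>P. balanced F"
  shows "refines E (ecycles E) P"
  unfolding refines_def
proof (intro conjI ballI P(1) cactus_partition[OF E])
  fix C assume C: "C \<in> ecycles E"
  then obtain e where e: "e \<in> C" "e \<in> E" using ecycle_nonempty by (auto simp: ecycles_def)
  then obtain F where F: "F \<in> P" "e \<in> F" using P(1) by (auto simp: partition_on_def)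
  then obtain C' where C': "ecycle C'" "e \<in> C'" "C' \<subseteq> F" using P(2) arc_in_ecycle by blast
  have "F \<subseteq> E" using F(1) P(1) by (auto simp: partition_on_def)
  then have "C = C'"
    using cactusD[OF E(2), of C C' e] C C' e(1) by (auto simp: ecycles_def)
  then show "\<exists>F\<in>P. C \<subseteq> F" using F(1) C'(3) by blast
qed

text \<open>In a cactus, a partition into cycles refines \<open>ecycles E\<close> and is refined by
  it. Conversely, each cycle extends to such a partition, its complement being balanced; under
  uniqueness two overlapping cycles are then parts of the same partition.\<close>

lemma cactus_iff_unique_partition:
  assumes E: "balanced E"
  shows "cactus E \<longleftrightarrow> (\<exists>!P. partition_on E P \<and> (\<forall>C\<in>P. ecycle C))"
proof
  assume cac: "cactus E"
  have eq: "P = ecycles E" if P: "partition_on E P" "\<forall>C\<in>P. ecycle C" for P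
  proof -
    have "refines E P (ecycles E)"
      using P cactus_partition[OF E cac] by (auto simp: refines_def ecycles_def partition_on_def)
    moreover have "refines E (ecycles E) P"
      using cactus_partition_refines[OF E cac] P ecycle_balanced by blast
    ultimately show ?thesis by (rule refines_asym)
  qed
  show "\<exists>!P. partition_on E P \<and> (\<forall>C\<in>P. ecycle C)"
  proof (rule ex1I[of _ "ecycles E"])
    show "partition_on E (ecycles E) \<and> (\<forall>C\<in>ecycles E. ecycle C)"
      using cactus_partition[OF E cac] by (simp add: ecycles_def)
  qed (use eq in blast)
next
  assume unique: "\<exists>!P. partition_on E P \<and> (\<forall>C\<in>P. ecycle C)"
  have extend: "\<exists>P. partition_on E P \<and> (\<forall>C\<in>P. ecycle C) \<and> X \<in> P" if X: "X \<in> ecycles E" for X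
  proof -
    have X': "ecycle X" "X \<subseteq> E" using X by (auto simp: ecycles_def)
    obtain P where P: "partition_on (E - X) P" "\<forall>C\<in>P. ecycle C"
      using partition_into_ecycles[OF balanced_Diff[OF E ecycle_balanced[OF X'(1)] X'(2)]] by blast
    have "disjnt X (\<Union>P)" using P(1) by (auto simp: partition_on_def disjnt_def)
    then have "partition_on E (insert X P)"
      using P(1) X' ecycle_nonempty by (simp add: partition_on_insert)
    then show ?thesis using P(2) X'(1) by blast
  qed
  show "cactus E"
    unfolding cactus_def
  proof (intro ballI impI)
    fix C C' assume C: "C \<in> ecycles E" "C' \<in> ecycles E" "C \<inter> C' \<noteq> {}"
    obtain P where P: "partition_on E P" "\<forall>C\<in>P. ecycle C" "C \<in> P" using extend[OF C(1)] by blast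
    obtain P' where P': "partition_on E P'" "\<forall>C\<in>P'. ecycle C" "C' \<in> P'" using extend[OF C(2)] by blast
    have "P = P'" using unique P(1,2) P'(1,2) by blast
    then show "C = C'" using P P' C(3) by (metis disjnt_def pairwiseD partition_onD2)
  qed
qed

end

lemma (in fin_digraph) eulerian_partitions_simps:
  "P \<in> carrier (eulerian_partitions G) \<longleftrightarrow>
    partition_on (arcs G) P \<and> (\<forall>F\<in>P. balanced F \<and> conn F)"
  "le (eulerian_partitions G) = refines (arcs G)"
  "eq (eulerian_partitions G) = (=)"
proof -
  have "connected (arc_subgraph G F) \<and> eulerian (arc_subgraph G F) \<longleftrightarrow> balanced F \<and> conn F"
    if "partition_on (arcs G) P" "F \<in> P" for F
  proof (rule arc_subgraph_eulerian_iff)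
    show "finite F" using that finite_subset[of F "arcs G"] by (auto simp: partition_on_def)
    show "F \<noteq> {}" using that by (auto simp: partition_on_def)
  qed
  then show "P \<in> carrier (eulerian_partitions G) \<longleftrightarrow>
    partition_on (arcs G) P \<and> (\<forall>F\<in>P. balanced F \<and> conn F)"
    unfolding eulerian_partitions_def by auto
qed (simp_all add: eulerian_partitions_def)

lemma (in fin_digraph) cactus_iff_lattice:
  assumes E: "balanced (arcs G)"
  shows "cactus (arcs G) \<longleftrightarrow>
    Lattice.lattice (eulerian_partitions G) \<and> (\<exists>!P. minimal (eulerian_partitions G) P)"
proof
  let ?L = "eulerian_partitions G"
  let ?E = "arcs G"
  assume cac: "cactus ?E"
  have bot: "ecycles ?E \<in> carrier ?L"
    using cactus_partition[OF E cac] ecycle_balanced ecycle_conn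
    by (auto simp: eulerian_partitions_simps ecycles_def)
  have bot_le: "refines ?E (ecycles ?E) P" if "P \<in> carrier ?L" for P
    using cactus_partition_refines[OF E cac] that by (auto simp: eulerian_partitions_simps)
  have po: "partial_order ?L"
    by (unfold_locales; unfold eulerian_partitions_simps)
      (metis refines_refl refines_asym refines_trans)+
  \<comment> \<open>Families of any size are treated, since meets are obtained as joins of whole
    sets of lower bounds.\<close>
  have lub: "\<exists>J. least ?L J (Upper ?L \<S>)" if S: "\<S> \<noteq> {}" "\<S> \<subseteq> carrier ?L" for \<S>
  proof -
    have "partition_on ?E P \<and> (\<forall>F\<in>P. balanced F \<and> conn F)" if "P \<in> \<S>" for P
      using S(2) that by (auto simp only: eulerian_partitions_simps(1)[symmetric])
    from ex_join[OF finite_arcs S(1) this]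
    obtain J where J: "J \<in> carrier ?L" "\<forall>P\<in>\<S>. refines ?E P J"
      "\<And>Z. Z \<in> carrier ?L \<Longrightarrow> \<forall>P\<in>\<S>. refines ?E P Z \<Longrightarrow> refines ?E J Z"
      unfolding eulerian_partitions_simps by blast
    have "x \<in> Upper ?L \<S> \<longleftrightarrow> x \<in> carrier ?L \<and> (\<forall>P\<in>\<S>. refines ?E P x)" for x
      using S(2) by (auto simp: Upper_def eulerian_partitions_simps(2))
    then have "least ?L J (Upper ?L \<S>)"
      using J by (auto simp: least_def eulerian_partitions_simps(2))
    then show ?thesis by blast
  qed
  \<comment> \<open>The meet is the join of all lower bounds, a family that is nonempty thanks to
    the least partition \<open>ecycles ?E\<close>.\<close>
  have glb: "\<exists>s. greatest ?L s (Lower ?L {x, y})" if xy: "x \<in> carrier ?L" "y \<in> carrier ?L" for x y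
  proof -
    let ?\<S> = "Lower ?L {x, y}"
    have "ecycles ?E \<in> ?\<S>"
      using bot bot_le xy by (auto simp: Lower_def eulerian_partitions_simps)
    moreover have "?\<S> \<subseteq> carrier ?L" by (auto simp: Lower_def)
    ultimately obtain J where J: "least ?L J (Upper ?L ?\<S>)" using lub[of ?\<S>] by blast
    then have "greatest ?L J ?\<S>"
      using xy by (auto simp: least_def greatest_def Upper_def Lower_def)
    then show ?thesis by blast
  qed
  have "upper_semilattice ?L"
    unfolding upper_semilattice_def upper_semilattice_axioms_def using po lub by auto
  moreover have "lower_semilattice ?L"
    unfolding lower_semilattice_def lower_semilattice_axioms_def using po glb by auto
  ultimately have "Lattice.lattice ?L" by (simp add: Lattice.lattice_def)
  moreover have "\<exists>!P. minimal ?L P"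
  proof (rule ex1I[of _ "ecycles ?E"])
    have "P = ecycles ?E" if "P \<in> carrier ?L" "refines ?E P (ecycles ?E)" for P
      using refines_asym[OF that(2) bot_le[OF that(1)]] .
    then show "minimal ?L (ecycles ?E)"
      using bot by (auto simp: minimal_def eulerian_partitions_simps(2))
    show "P = ecycles ?E" if "minimal ?L P" for P
      using that bot bot_le by (auto simp: minimal_def eulerian_partitions_simps(2))
  qed
  ultimately show "Lattice.lattice ?L \<and> (\<exists>!P. minimal ?L P)" by blast
next
  let ?L = "eulerian_partitions G"
  let ?E = "arcs G"
  assume "Lattice.lattice ?L \<and> (\<exists>!P. minimal ?L P)"
  then have unique: "\<exists>!P. minimal ?L P" by blast
  \<comment> \<open>A part inside a cycle is a nonempty balanced subset of it, hence the cycle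
    itself, so nothing lies strictly below a partition into cycles.\<close>
  have min: "minimal ?L P" if P: "partition_on ?E P" "\<forall>C\<in>P. ecycle C" for P
    unfolding minimal_def
  proof (intro conjI ballI impI)
    show "P \<in> carrier ?L" using P ecycle_balanced ecycle_conn by (simp add: eulerian_partitions_simps)
    fix Q assume Q: "Q \<in> carrier ?L" "le ?L Q P"
    have ref: "refines ?E Q P" using Q(2) by (simp add: eulerian_partitions_simps)
    have "Q \<subseteq> P"
    proof
      fix Y assume Y: "Y \<in> Q"
      then obtain C where C: "C \<in> P" "Y \<subseteq> C" using ref by (auto simp: refines_def)
      have "balanced Y" "Y \<noteq> {}"
        using Q(1) Y by (auto simp: eulerian_partitions_simps partition_on_def)
      then have "Y = C" using ecycle_minimal P(2) C by blast
      then show "Y \<in> P" using C(1) by simp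
    qed
    moreover have "P \<subseteq> Q"
    proof
      fix C assume C: "C \<in> P"
      then obtain e where e: "e \<in> C" using P(2) ecycle_nonempty by blast
      then have "e \<in> ?E" using C partition_onD1[OF P(1)] by blast
      then obtain Y where Y: "Y \<in> Q" "e \<in> Y"
        using partition_onD1[of ?E Q] ref by (auto simp: refines_def)
      then have "Y = C"
        using partition_onD2[OF P(1)] \<open>Q \<subseteq> P\<close> C e by (meson disjnt_iff pairwiseD subsetD)
      then show "C \<in> Q" using Y(1) by simp
    qed
    ultimately show "Q = P" by blast
  qed
  obtain P where P: "partition_on ?E P" "\<forall>C\<in>P. ecycle C" using partition_into_ecycles[OF E] by blast
  have "\<exists>!P. partition_on ?E P \<and> (\<forall>C\<in>P. ecycle C)"
  proof (rule ex1I[of _ P])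
    show "Q = P" if Q: "partition_on ?E Q \<and> (\<forall>C\<in>Q. ecycle C)" for Q
      using unique min[of Q] min[OF P] Q by blast
  qed (use P in blast)
  then show "cactus ?E" using cactus_iff_unique_partition[OF E] by blast
qed

section \<open>The equivalences\<close>

context wf_digraph begin

text \<open>Injectivity of \<open>circuit_arcs\<close> turns disjointness of the indexed family into
  disjointness of the set of arc sets, and no cycle has an empty arc set.\<close>

lemma cycle_partition_iff:
  "cycle_partition G A \<longleftrightarrow> A \<subseteq> cycles G \<and> partition_on (arcs G) (circuit_arcs ` A)"
proof (cases "A \<subseteq> cycles G")
  case True
  have inj: "inj_on circuit_arcs A" using inj_on_circuit_arcs True by (rule inj_on_subset)
  have "{} \<notin> circuit_arcs ` A"
  proof
    assume "{} \<in> circuit_arcs ` A"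
    then have "{} \<in> ecycles (arcs G)" using circuit_arcs_cycles True by blast
    then show False using ecycle_nonempty by (auto simp: ecycles_def)
  qed
  moreover have "disjoint (circuit_arcs ` A) \<longleftrightarrow> disjoint_family_on circuit_arcs A"
    using inj by (auto simp: pairwise_def disjnt_def disjoint_family_on_def inj_on_eq_iff)
  ultimately show ?thesis using True by (auto simp: cycle_partition_def partition_on_def)
qed (simp add: cycle_partition_def)

lemma ex1_cycle_partition_iff:
  "(\<exists>!A. cycle_partition G A) \<longleftrightarrow> (\<exists>!P. partition_on (arcs G) P \<and> (\<forall>C\<in>P. ecycle C))"
proof -
  \<comment> \<open>\<open>A\<close> inverts the image under \<open>circuit_arcs\<close>, so
    partitions into circuits correspond to partitions into minimal balanced sets.\<close>
  define A where "A P = {c \<in> cycles G. circuit_arcs c \<in> P}" for P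
  have part: "cycle_partition G (A P) \<and> circuit_arcs ` A P = P"
    if P: "partition_on (arcs G) P \<and> (\<forall>C\<in>P. ecycle C)" for P
  proof -
    have "P \<subseteq> ecycles (arcs G)" using P by (auto simp: ecycles_def partition_on_def)
    then have "P \<subseteq> circuit_arcs ` cycles G" by (simp only: circuit_arcs_cycles)
    then have "circuit_arcs ` A P = P" unfolding A_def by blast
    then show ?thesis using P by (simp add: cycle_partition_iff) (simp add: A_def)
  qed
  have ecyc: "partition_on (arcs G) (circuit_arcs ` B) \<and> (\<forall>C\<in>circuit_arcs ` B. ecycle C) \<and>
      A (circuit_arcs ` B) = B" if B: "cycle_partition G B" for B
  proof -
    have sub: "B \<subseteq> cycles G" using B by (simp add: cycle_partition_iff)
    have "circuit_arcs ` B \<subseteq> ecycles (arcs G)"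
      unfolding circuit_arcs_cycles[symmetric] using sub by (rule image_mono)
    then have "\<forall>C\<in>circuit_arcs ` B. ecycle C" by (auto simp: ecycles_def)
    moreover have "A (circuit_arcs ` B) = B"
      unfolding A_def using sub inj_on_image_mem_iff[OF inj_on_circuit_arcs _ sub] by blast
    ultimately show ?thesis using B by (simp add: cycle_partition_iff)
  qed
  show ?thesis
  proof
    assume "\<exists>!B. cycle_partition G B"
    then obtain B where B: "cycle_partition G B" "\<And>B'. cycle_partition G B' \<Longrightarrow> B' = B" by blast
    show "\<exists>!P. partition_on (arcs G) P \<and> (\<forall>C\<in>P. ecycle C)"
    proof (rule ex1I[of _ "circuit_arcs ` B"])
      show "P = circuit_arcs ` B" if "partition_on (arcs G) P \<and> (\<forall>C\<in>P. ecycle C)" for P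
        using part[OF that] B(2) by blast
    qed (use ecyc[OF B(1)] in blast)
  next
    assume "\<exists>!P. partition_on (arcs G) P \<and> (\<forall>C\<in>P. ecycle C)"
    then obtain P where P: "partition_on (arcs G) P \<and> (\<forall>C\<in>P. ecycle C)"
      "\<And>P'. partition_on (arcs G) P' \<and> (\<forall>C\<in>P'. ecycle C) \<Longrightarrow> P' = P" by blast
    show "\<exists>!B. cycle_partition G B"
    proof (rule ex1I[of _ "A P"])
      show "B = A P" if "cycle_partition G B" for B
        using ecyc[OF that] P(2)[of "circuit_arcs ` B"] by simp
    qed (use part[OF P(1)] in blast)
  qed
qed

lemma cactus_iff_cycles_disjoint:
  "cactus (arcs G) \<longleftrightarrow>
    (\<forall>c\<in>cycles G. \<forall>c'\<in>cycles G. c \<noteq> c' \<longrightarrow> circuit_arcs c \<inter> circuit_arcs c' = {})"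
  unfolding cactus_def circuit_arcs_cycles[symmetric]
  by (simp add: inj_on_eq_iff[OF inj_on_circuit_arcs]) blast

text \<open>Balance puts every arc on some cycle, so only uniqueness is at stake.\<close>

lemma cactus_iff_unique_cycle_through_arc:
  assumes "balanced (arcs G)"
  shows "cactus (arcs G) \<longleftrightarrow> (\<forall>e\<in>arcs G. \<exists>!c. c \<in> cycles G \<and> e \<in> circuit_arcs c)"
proof -
  have cover: "\<exists>c. c \<in> cycles G \<and> e \<in> circuit_arcs c" if e: "e \<in> arcs G" for e
  proof -
    obtain C where "C \<in> ecycles (arcs G)" "e \<in> C"
      using arc_in_ecycle[OF assms e] by (auto simp: ecycles_def)
    then show ?thesis unfolding circuit_arcs_cycles[symmetric] by blast
  qed
  have sub: "circuit_arcs c \<subseteq> arcs G" if "c \<in> cycles G" for c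
  proof -
    have "circuit_arcs c \<in> ecycles (arcs G)" using that circuit_arcs_cycles by blast
    then show ?thesis by (simp add: ecycles_def)
  qed
  show ?thesis
    unfolding cactus_iff_cycles_disjoint
  proof
    assume disj: "\<forall>c\<in>cycles G. \<forall>c'\<in>cycles G. c \<noteq> c' \<longrightarrow> circuit_arcs c \<inter> circuit_arcs c' = {}"
    show "\<forall>e\<in>arcs G. \<exists>!c. c \<in> cycles G \<and> e \<in> circuit_arcs c"
    proof
      fix e assume "e \<in> arcs G"
      then obtain c where c: "c \<in> cycles G \<and> e \<in> circuit_arcs c" using cover by blast
      show "\<exists>!c. c \<in> cycles G \<and> e \<in> circuit_arcs c"
      proof (rule ex1I[of _ c])
        show "d = c" if "d \<in> cycles G \<and> e \<in> circuit_arcs d" for d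
          using disj c that by (meson disjoint_iff)
      qed (rule c)
    qed
  next
    assume unique: "\<forall>e\<in>arcs G. \<exists>!c. c \<in> cycles G \<and> e \<in> circuit_arcs c"
    show "\<forall>c\<in>cycles G. \<forall>c'\<in>cycles G. c \<noteq> c' \<longrightarrow> circuit_arcs c \<inter> circuit_arcs c' = {}"
    proof (intro ballI impI equals0I)
      fix c c' e assume c: "c \<in> cycles G" "c' \<in> cycles G" "c \<noteq> c'" "e \<in> circuit_arcs c \<inter> circuit_arcs c'"
      then have "e \<in> arcs G" using sub by blast
      then show False using unique c by blast
    qed
  qed
qed

lemma cactus_iff_cycle_partition:
  assumes "balanced (arcs G)"
  shows "cactus (arcs G) \<longleftrightarrow> cycle_partition G (cycles G)"
proof
  assume "cactus (arcs G)"
  then show "cycle_partition G (cycles G)"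
    using cactus_partition[OF assms] by (simp add: cycle_partition_iff circuit_arcs_cycles)
next
  assume "cycle_partition G (cycles G)"
  then show "cactus (arcs G)"
    unfolding cactus_iff_cycles_disjoint
    by (auto simp: cycle_partition_def disjoint_family_on_def)
qed

end

theorem mainTheorem1:
  fixes D :: "('a,'b) pre_digraph"
  assumes "fin_digraph D" and "loopfree_digraph D"
    and "connected D" and "eulerian D"
  shows "let
      P1 = (\<forall>c\<in>cycles D. \<forall>c'\<in>cycles D. c \<noteq> c' \<longrightarrow> circuit_arcs c \<inter> circuit_arcs c' = {});
      P2 = (\<forall>e\<in>arcs D. \<exists>!c. c \<in> cycles D \<and> e \<in> circuit_arcs c);
      P3 = cycle_partition D (cycles D);
      P4 = (\<exists>!A. cycle_partition D A);
      P5 = (D \<in> cycle_closure);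
      P6 = (int (card (cycles D)) = int (card (arcs D)) - int (card (verts D)) + 1);
      P7 = (\<forall>u\<in>verts D. \<exists>!T. arborescence D u T);
      P8 = (Lattice.lattice (eulerian_partitions D) \<and> (\<exists>!P. minimal (eulerian_partitions D) P))
    in (P1 \<longleftrightarrow> P2) \<and> (P2 \<longleftrightarrow> P3) \<and> (P3 \<longleftrightarrow> P4) \<and> (P4 \<longleftrightarrow> P5) \<and> (P5 \<longleftrightarrow> P6) \<and> (P6 \<longleftrightarrow> P7) \<and> (P7 \<longleftrightarrow> P8)"
proof -
  interpret fin_digraph D by (rule assms(1))
  interpret loopfree_digraph D by (rule assms(2))
  have ne: "arcs D \<noteq> {}" and V: "verts D = ends (arcs D)"
    and bal: "balanced (arcs D)" and con: "conn (arcs D)"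
    using connected_eulerian_iff assms(3,4) by blast+
  have closure: "cactus (arcs D) \<longleftrightarrow> D \<in> cycle_closure"
  proof
    assume "cactus (arcs D)"
    then have "arc_subgraph D (arcs D) \<in> cycle_closure"
      using cactus_in_cycle_closure[OF subset_refl bal con ne] by blast
    \<comment> \<open>There are no isolated vertices, so the arcs recover all of
      \<open>D\<close>.\<close>
    moreover have "arc_subgraph D (arcs D) = D" using V by (simp add: arc_subgraph_def ends_def)
    ultimately show "D \<in> cycle_closure" by simp
  qed (use cycle_closure_cactus in blast)
  have "card (cycles D) = card (ecycles (arcs D))"
    using card_image[OF inj_on_circuit_arcs] by (simp add: circuit_arcs_cycles)
  then have count: "cactus (arcs D) \<longleftrightarrow>
      int (card (cycles D)) = int (card (arcs D)) - int (card (verts D)) + 1"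
    using card_ecycles[OF bal con ne] V by auto
  show ?thesis
    unfolding Let_def
    using cactus_iff_cycles_disjoint cactus_iff_unique_cycle_through_arc[OF bal]
      cactus_iff_cycle_partition[OF bal] cactus_iff_unique_partition[OF bal]
      ex1_cycle_partition_iff closure count cactus_iff_unique_arborescence[OF bal con V]
      cactus_iff_lattice[OF bal]
    by presburger
qed

end
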